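(* Let $S=\mathbb{K}[x_1,\ldots,x_n]$ be a polynomial ring over a field $\mathbb{K}$, and let $I=(u_1,u_2,x_1^{e_1},\ldots,x_n^{e_n})$, where $u_1=x_1^{a_1}\cdots x_n^{a_n}$ and $u_2=x_1^{b_1}\cdots x_n^{b_n}$ are monomials, neither dividing the other and neither a pure power of a variable, with $a_i+b_i>0$ and $e_i>\max\{a_i,b_i\}$ for all $i\in[n]$. Put $P_0=\{i+2: a_i=b_i\}$, $P_1=\{i+2: a_i>b_i\}$, $P_2=\{i+2: a_i<b_i\}$, $A=\{i+2: a_i>0\}$, $B=\{i+2: b_i>0\}$ ($i$ ranging over $[n]$). Then $S/I$ is a level algebra if and only if there exist constants $\alpha,\beta,\gamma$ such that (i) $a_i-e_i=\alpha$ for all $i+2\in P_1$; (ii) $b_i-e_i=\beta$ for all $i+2\in P_2$; (iii) $a_i-e_i=\gamma$ for all $i+2\in(P_2\cap A)\cup P_0$, and $b_j-e_j=\gamma$ for all $j+2\in P_1\cap B$; (iv) $\gamma=\alpha+\beta$.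
   Context: An Artinian standard graded algebra $R=S/I$ is a level algebra if there is exactly one shift in the last free module of its minimal graded free resolution over $S$, i.e. all generators of the last free module have the same (total, $\mathbb{Z}$-graded) degree. *)

theory Defs
  imports "HOL-Library.Poly_Mapping" "Jordan_Normal_Form.Matrix_Kernel"
begin

text \<open>
  The polynomial ring \<open>S = K[x\<^sub>1, \<dots>, x\<^sub>n]\<close> is the monoid algebra of the exponent vectors
  \<^typ>\<open>'n \<Rightarrow>\<^sub>0 nat\<close>; its variables are indexed by a finite type \<^typ>\<open>'n\<close> with \<open>n\<close> elements.
\<close>

type_synonym ('n, 'k) mpoly = "('n \<Rightarrow>\<^sub>0 nat) \<Rightarrow>\<^sub>0 'k"

definition Var :: "'n \<Rightarrow> ('n, 'k::field) mpoly"
  where "Var i = Poly_Mapping.single (Poly_Mapping.single i 1) 1"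

definition mono_deg :: "('n::finite \<Rightarrow>\<^sub>0 nat) \<Rightarrow> nat"
  where "mono_deg m = (\<Sum>i\<in>UNIV. Poly_Mapping.lookup m i)"

text \<open>The zero polynomial is homogeneous of every degree, and the only one of negative degree.\<close>

definition homogeneous :: "int \<Rightarrow> ('n::finite, 'k::field) mpoly \<Rightarrow> bool"
  where "homogeneous t f \<longleftrightarrow> (\<forall>m\<in>Poly_Mapping.keys f. int (mono_deg m) = t)"

text \<open>
  Ideals are the submodules of a ring regarded as a module over itself. The qualifier is needed
  because HOL-Algebra has a locale \<open>module\<close> too.
\<close>

lemma module_times: "Modules.module ((*) :: 'a \<Rightarrow> 'a \<Rightarrow> 'a::comm_ring_1)"
  by unfold_locales (simp_all add: algebra_simps)

abbreviation is_ideal :: "'a::comm_ring_1 set \<Rightarrow> bool"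
  where "is_ideal \<equiv> Modules.module.subspace (*)"

abbreviation ideal_gen :: "'a::comm_ring_1 set \<Rightarrow> 'a set"
  where "ideal_gen \<equiv> Modules.module.span (*)"

definition maximal_homogeneous_ideal :: "('n, 'k::field) mpoly set"
  where "maximal_homogeneous_ideal = ideal_gen (range Var)"

definition homogeneous_ideal :: "('n::finite, 'k::field) mpoly set \<Rightarrow> bool"
  where "homogeneous_ideal I \<longleftrightarrow> (\<exists>G. (\<forall>g\<in>G. \<exists>t. homogeneous t g) \<and> I = ideal_gen G)"

text \<open>
  \<open>S/I\<close> is never formed as a type: its ideals are represented by the ideals of \<open>S\<close> containing \<open>I\<close>,
  and maps into it by maps into \<open>S\<close> considered modulo \<open>I\<close>.
\<close>

definition artinian_quotient :: "'a::comm_ring_1 set \<Rightarrow> bool"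
  where "artinian_quotient I \<longleftrightarrow>
    (\<forall>J :: nat \<Rightarrow> 'a set.
      (\<forall>k. is_ideal (J k) \<and> I \<subseteq> J k) \<and> (\<forall>k. J (Suc k) \<subseteq> J k)
      \<longrightarrow> (\<exists>N. \<forall>k\<ge>N. J k = J N))"

text \<open>
  A list \<open>s\<close> of integers stands for the graded free module \<open>\<Oplus>\<^sub>j S(-s ! j)\<close>, whose \<open>j\<close>-th basis
  vector has degree \<open>s ! j\<close> and whose underlying module is \<open>carrier_vec (length s)\<close>. Hence a
  matrix is a homomorphism of degree \<open>0\<close> exactly when its \<open>(k, j)\<close> entry is homogeneous of
  degree \<open>s ! j - t ! k\<close>.
\<close>

definition graded_map :: "int list \<Rightarrow> int list \<Rightarrow> ('n::finite, 'k::field) mpoly mat \<Rightarrow> bool"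
  where "graded_map s t A \<longleftrightarrow>
    A \<in> carrier_mat (length t) (length s) \<and>
    (\<forall>k<length t. \<forall>j<length s. homogeneous (s ! j - t ! k) (A $$ (k, j)))"

definition mat_image :: "'a::comm_ring_1 mat \<Rightarrow> 'a vec set"
  where "mat_image A = (\<lambda>v. A *\<^sub>v v) ` carrier_vec (dim_col A)"

text \<open>
  A graded free resolution
  \[ \cdots \longrightarrow F_2 \stackrel{\varphi_2}{\longrightarrow} F_1
     \stackrel{\varphi_1}{\longrightarrow} F_0 \longrightarrow S/I \longrightarrow 0 \]
  by finitely generated modules. The list \<open>d i\<close> holds the shifts of \<open>F\<^sub>i\<close>, so \<open>F\<^sub>i = 0\<close> iff
  \<open>d i = []\<close>; the matrix \<open>\<phi> i\<close> is the differential from \<open>F\<^sub>i\<close> to \<open>F\<^sub>i\<^sub>-\<^sub>1\<close> for \<open>i > 0\<close>, while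
  \<open>\<phi> 0\<close> is unused; the augmentation sends \<open>v\<close> to the class of \<open>g \<bullet> v\<close> modulo \<open>I\<close>.
\<close>

definition graded_free_resolution ::
  "('n::finite, 'k::field) mpoly set \<Rightarrow> (nat \<Rightarrow> int list) \<Rightarrow> (nat \<Rightarrow> ('n, 'k) mpoly mat)
    \<Rightarrow> ('n, 'k) mpoly vec \<Rightarrow> bool"
  where "graded_free_resolution I d \<phi> g \<longleftrightarrow>
    (\<forall>i. graded_map (d (Suc i)) (d i) (\<phi> (Suc i))) \<and>
    g \<in> carrier_vec (length (d 0)) \<and>
    (\<forall>j<length (d 0). homogeneous (d 0 ! j) (g $ j)) \<and>
    (\<forall>f. \<exists>v\<in>carrier_vec (length (d 0)). f - g \<bullet> v \<in> I) \<and>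
    {v \<in> carrier_vec (length (d 0)). g \<bullet> v \<in> I} = mat_image (\<phi> 1) \<and>
    (\<forall>i. mat_kernel (\<phi> (Suc i)) = mat_image (\<phi> (Suc (Suc i))))"

text \<open>Minimality says that \<open>\<phi>\<^sub>i(F\<^sub>i)\<close> is contained in the maximal homogeneous ideal times \<open>F\<^sub>i\<^sub>-\<^sub>1\<close>.\<close>

definition minimal_graded_free_resolution ::
  "('n::finite, 'k::field) mpoly set \<Rightarrow> (nat \<Rightarrow> int list) \<Rightarrow> (nat \<Rightarrow> ('n, 'k) mpoly mat)
    \<Rightarrow> ('n, 'k) mpoly vec \<Rightarrow> bool"
  where "minimal_graded_free_resolution I d \<phi> g \<longleftrightarrow>
    graded_free_resolution I d \<phi> g \<and>
    (\<forall>i. elements_mat (\<phi> (Suc i)) \<subseteq> maximal_homogeneous_ideal)"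

definition last_free_module :: "(nat \<Rightarrow> int list) \<Rightarrow> nat \<Rightarrow> bool"
  where "last_free_module d p \<longleftrightarrow> d p \<noteq> [] \<and> (\<forall>i>p. d i = [])"

text \<open>
  The minimal graded free resolution is unique up to isomorphism, so it does not matter which one
  witnesses the existential quantifier.
\<close>

definition level_algebra :: "('n::finite, 'k::field) mpoly set \<Rightarrow> bool"
  where "level_algebra I \<longleftrightarrow>
    homogeneous_ideal I \<and> artinian_quotient I \<and>
    (\<exists>d \<phi> g p. minimal_graded_free_resolution I d \<phi> g \<and> last_free_module d p \<and>
      card (set (d p)) = 1)"

end

theory Submission
  imports Defs "HOL-Library.Function_Algebras"
begin

text \<open>
  A monomial \<open>m \<notin> I\<close> is a corner of \<open>I\<close> if \<open>x\<^sub>i m \<in> I\<close> for all \<open>i\<close>; the corners form a basis of the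
  socle of \<open>S/I\<close>. By balancing Tor, the last module of a minimal resolution of \<open>S/I\<close> sits in
  homological degree \<open>n\<close> and its shifts are the socle degrees plus \<open>n\<close>; hence \<open>S/I\<close> is level iff all
  corners have the same degree. A corner is \<open>x\<^sup>e\<^sup>-\<^sup>1\<close> with the exponent lowered at an \<open>i \<in> A \<inter> B\<close> to
  \<open>min a\<^sub>i b\<^sub>i - 1\<close>, or with exponents lowered to \<open>a\<^sub>i - 1\<close> and \<open>b\<^sub>j - 1\<close> for some \<open>i \<in> P\<^sub>1\<close>,
  \<open>j \<in> P\<^sub>2\<close>, and comparing degrees yields the four conditions.

  Instead of Tor we use vanishing of Koszul homology degree by degree: if \<open>F' \<rightarrow> F\<close> has image \<open>N\<close> and
  kernel \<open>N'\<close>, then \<open>H\<^sub>j(F/N)\<close> vanishes in degree \<open>t\<close> iff \<open>H\<^sub>j\<^sub>-\<^sub>1(F'/N')\<close> does (for \<open>j = 1\<close> this needs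
  minimality). Walking along the resolution turns the socle \<open>H\<^sub>n(S/I)\<close> into \<open>H\<^sub>0\<close> of the
  \<open>n\<close>-th syzygy, that is, into the shifts of \<open>F\<^sub>n\<close>. The same shift gives the existence of minimal
  resolutions without Hilbert's basis theorem: \<open>S/I\<close> is zero in large degrees, so each syzygy module
  is generated in bounded degrees.
\<close>

section \<open>Homogeneous components\<close>

text \<open>Put N = F'/N' and use 0 -> N -> F -> F/N -> 0. For j >= 2 the homology of the free
  module F drops out of the long exact sequence. For j = 1 the term H_0(F) = F/mF remains, m being
  the maximal homogeneous ideal; the map from H_0(N) to it is zero exactly when N lies in mF, which
  is minimality.

  No homology module is formed. One predicate, vanishing in a single internal degree, carries all
  the data: for j = 0 and N in mF it tells which shifts occur, for j = 1 that N needs no new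
  generators in that degree, for j = n it speaks of the socle, and beyond n it always holds, which
  bounds the length of the resolution.

  Levelness asks for a resolution to exist, so one direction has to build one. Vanishing for all j
  >= 1 in large degrees passes to the next syzygy module because its H_j is the old H_(j+1).

  Since neither monomial divides the other, \<open>P\<^sub>1\<close> and \<open>P\<^sub>2\<close>
  are nonempty. So a corner with two lowered exponents always exists, and comparing all other
  corners with its degree produces (iv).\<close>

lemma homogeneous_0 [simp]: "homogeneous t 0"
  by (simp add: homogeneous_def)

lemma mono_deg_add [simp]: "mono_deg (m + m') = mono_deg m + mono_deg m'"
  by (simp add: mono_deg_def lookup_add sum.distrib)

lemma mono_deg_0 [simp]: "mono_deg 0 = 0"
  by (simp add: mono_deg_def)

lemma mono_deg_single [simp]: "mono_deg (Poly_Mapping.single i k) = k"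
  by (simp add: mono_deg_def lookup_single when_def)

lemma mono_deg_eq_0_iff [simp]: "mono_deg m = 0 \<longleftrightarrow> m = 0"
proof -
  have "mono_deg m = 0 \<longleftrightarrow> (\<forall>i. Poly_Mapping.lookup m i = 0)"
    unfolding mono_deg_def by simp
  also have "\<dots> \<longleftrightarrow> m = 0"
    by (simp add: poly_mapping_eq_iff fun_eq_iff)
  finally show ?thesis .
qed

lemma homogeneous_mult:
  "homogeneous s f \<Longrightarrow> homogeneous t g \<Longrightarrow> homogeneous (s + t) (f * g)"
  unfolding homogeneous_def using keys_mult[of f g] by fastforce

lemma homogeneous_Var [simp]: "homogeneous 1 (Var i)"
  by (simp add: homogeneous_def Var_def)

lemma homogeneous_single: "homogeneous (int (mono_deg m)) (Poly_Mapping.single m c)"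
  by (simp add: homogeneous_def)

definition hom_comp :: "int \<Rightarrow> ('n::finite, 'k::field) mpoly \<Rightarrow> ('n, 'k) mpoly"
  where "hom_comp t = Poly_Mapping.mapp (\<lambda>m c. if int (mono_deg m) = t then c else 0)"

lemma lookup_hom_comp:
  "Poly_Mapping.lookup (hom_comp t f) m = (if int (mono_deg m) = t then Poly_Mapping.lookup f m else 0)"
  by (auto simp: hom_comp_def lookup_mapp when_def in_keys_iff)

lemma keys_hom_comp:
  "Poly_Mapping.keys (hom_comp t f) = {m \<in> Poly_Mapping.keys f. int (mono_deg m) = t}"
  by (auto simp: in_keys_iff lookup_hom_comp split: if_splits)

lemma homogeneous_hom_comp [simp]: "homogeneous t (hom_comp t f)"
  by (simp add: homogeneous_def keys_hom_comp)

lemma hom_comp_0 [simp]: "hom_comp t 0 = 0"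
  by (rule poly_mapping_eqI) (simp add: lookup_hom_comp)

lemma hom_comp_add: "hom_comp t (f + g) = hom_comp t f + hom_comp t g"
  by (rule poly_mapping_eqI) (simp add: lookup_hom_comp lookup_add)

lemma hom_comp_uminus: "hom_comp t (- f) = - hom_comp t f"
  by (rule poly_mapping_eqI) (simp add: lookup_hom_comp)

lemma hom_comp_diff: "hom_comp t (f - g) = hom_comp t f - hom_comp t g"
  by (rule poly_mapping_eqI) (simp add: lookup_hom_comp lookup_minus)

lemma hom_comp_sum: "hom_comp t (sum f A) = (\<Sum>x\<in>A. hom_comp t (f x))"
  by (induction A rule: infinite_finite_induct) (simp_all add: hom_comp_add)

lemma hom_comp_eq_0_iff: "hom_comp t f = 0 \<longleftrightarrow> (\<forall>m\<in>Poly_Mapping.keys f. int (mono_deg m) \<noteq> t)"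
  by (auto simp: poly_mapping_eq_iff fun_eq_iff lookup_hom_comp in_keys_iff)

lemma hom_comp_id_iff: "hom_comp t f = f \<longleftrightarrow> homogeneous t f"
  by (auto simp: poly_mapping_eq_iff fun_eq_iff lookup_hom_comp homogeneous_def in_keys_iff)

text \<open>Multiplication by \<open>h\<close> shifts every degree by exactly \<open>s\<close>, so
  the rest \<open>r\<close> of \<open>f\<close> outside degree \<open>t - s\<close> cannot reach
  degree \<open>t\<close>.\<close>

lemma hom_comp_mult:
  assumes "homogeneous s h"
  shows "hom_comp t (h * f) = h * hom_comp (t - s) f"
proof -
  define r where "r = f - hom_comp (t - s) f"
  have "int (mono_deg m) \<noteq> t - s" if "m \<in> Poly_Mapping.keys r" for m
    using that by (auto simp: r_def in_keys_iff lookup_minus lookup_hom_comp)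
  hence "int (mono_deg m) \<noteq> t" if "m \<in> Poly_Mapping.keys (h * r)" for m
    using that keys_mult[of h r] assms unfolding homogeneous_def by fastforce
  hence 1: "hom_comp t (h * r) = 0" by (simp add: hom_comp_eq_0_iff)
  have 2: "hom_comp t (h * hom_comp (t - s) f) = h * hom_comp (t - s) f"
    using homogeneous_mult[OF assms homogeneous_hom_comp[of "t - s" f]] by (simp add: hom_comp_id_iff)
  have "f = hom_comp (t - s) f + r" by (simp add: r_def)
  hence "hom_comp t (h * f) = hom_comp t (h * hom_comp (t - s) f) + hom_comp t (h * r)"
    by (metis distrib_left hom_comp_add)
  thus ?thesis using 1 2 by simp
qed

lemma sum_hom_comp:
  assumes "finite D" and "\<And>m. m \<in> Poly_Mapping.keys f \<Longrightarrow> int (mono_deg m) \<in> D"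
  shows "(\<Sum>t\<in>D. hom_comp t f) = f"
proof (rule poly_mapping_eqI)
  fix m
  show "Poly_Mapping.lookup (\<Sum>t\<in>D. hom_comp t f) m = Poly_Mapping.lookup f m"
    using assms by (cases "m \<in> Poly_Mapping.keys f")
      (auto simp: lookup_sum lookup_hom_comp in_keys_iff if_distrib sum.delta cong: if_cong)
qed

lemma homogeneous_0_const:
  assumes "homogeneous 0 f"
  shows "f = Poly_Mapping.single 0 (Poly_Mapping.lookup f 0)"
  using assms by (intro poly_mapping_eqI)
      (auto simp: homogeneous_def lookup_single when_def in_keys_iff)

lemma lookup_times_single_single:
  fixes f :: "('n \<Rightarrow>\<^sub>0 nat) \<Rightarrow>\<^sub>0 'k::field"
  shows "Poly_Mapping.lookup (Poly_Mapping.single m c * f) (m + m') = c * Poly_Mapping.lookup f m'"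
  by (simp add: lookup_mult lookup_single when_mult Sum_any_when_dependent_prod_left)

section \<open>The Koszul complex\<close>

text \<open>Elements of \<open>S\<^sup>r\<close> are functions vanishing from index \<open>r\<close> on, so that vectors of all ranks
share one type.\<close>

type_synonym ('n, 'k) fvec = "nat \<Rightarrow> ('n, 'k) mpoly"

definition smul :: "('n, 'k::field) mpoly \<Rightarrow> ('n, 'k) fvec \<Rightarrow> ('n, 'k) fvec"
  where "smul f v = (\<lambda>k. f * v k)"

interpretation fvec: Modules.module smul
  by unfold_locales (auto simp: smul_def fun_eq_iff algebra_simps)

interpretation ideals: Modules.module "(*) :: 'a \<Rightarrow> 'a \<Rightarrow> 'a::comm_ring_1"
  by (rule module_times)

lemma smul_apply: "smul f v k = f * v k"
  by (simp add: smul_def)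

text \<open>With the pointwise rules in the simpset, eta-expanded vectors are unfolded
and module lemmas no longer match.\<close>

lemmas fvec_apply = smul_apply plus_fun_apply minus_apply uminus_apply zero_fun_apply

declare plus_fun_apply [simp del] minus_apply [simp del] uminus_apply [simp del]
  zero_fun_apply [simp del]

text \<open>The ideal generated by the variables in \<open>X\<close>, given by its monomials so that
  membership can be tested term by term. For \<open>X = UNIV\<close> it is the maximal homogeneous
  ideal.\<close>

definition var_ideal :: "'n set \<Rightarrow> ('n, 'k::field) mpoly set"
  where "var_ideal X = {f. \<forall>m\<in>Poly_Mapping.keys f. \<exists>x\<in>X. Poly_Mapping.lookup m x \<noteq> 0}"

lemma var_ideal_0 [simp]: "0 \<in> var_ideal X"
  by (simp add: var_ideal_def)

lemma var_ideal_add: "f \<in> var_ideal X \<Longrightarrow> g \<in> var_ideal X \<Longrightarrow> f + g \<in> var_ideal X"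
  unfolding var_ideal_def using Poly_Mapping.keys_add[of f g] by blast

lemma var_ideal_uminus [simp]: "- f \<in> var_ideal X \<longleftrightarrow> f \<in> var_ideal X"
  by (simp add: var_ideal_def in_keys_iff)

lemma var_ideal_mult: "f \<in> var_ideal X \<Longrightarrow> g * f \<in> var_ideal X"
  unfolding var_ideal_def
proof safe
  fix m assume f: "\<forall>m\<in>Poly_Mapping.keys f. \<exists>x\<in>X. Poly_Mapping.lookup m x \<noteq> 0"
    and "m \<in> Poly_Mapping.keys (g * f)"
  then obtain a b where "m = a + b" "b \<in> Poly_Mapping.keys f" using keys_mult[of g f] by blast
  moreover from this f obtain x where "x \<in> X" "Poly_Mapping.lookup b x \<noteq> 0" by blast
  ultimately show "\<exists>x\<in>X. Poly_Mapping.lookup m x \<noteq> 0"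
    by (intro bexI[of _ x]) (simp_all add: lookup_add)
qed

lemma var_ideal_Var: "x \<in> X \<Longrightarrow> Var x \<in> var_ideal X"
  by (auto simp: var_ideal_def Var_def intro!: bexI[of _ x])

lemma var_ideal_mono: "f \<in> var_ideal X \<Longrightarrow> X \<subseteq> Y \<Longrightarrow> f \<in> var_ideal Y"
  unfolding var_ideal_def by blast

lemma var_ideal_UNIV: "f \<in> var_ideal UNIV \<longleftrightarrow> Poly_Mapping.lookup f 0 = 0"
proof -
  have "(\<exists>x. Poly_Mapping.lookup m x \<noteq> 0) \<longleftrightarrow> m \<noteq> 0" for m :: "'a \<Rightarrow>\<^sub>0 nat"
    by (auto simp: poly_mapping_eq_iff fun_eq_iff)
  thus ?thesis by (auto simp: var_ideal_def in_keys_iff)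
qed

lemma lookup_Var_mult:
  "Poly_Mapping.lookup (Var x * f) (Poly_Mapping.single x 1 + m) = Poly_Mapping.lookup f m"
  unfolding Var_def by (subst lookup_times_single_single) simp

lemma keys_Var_mult:
  "Poly_Mapping.keys (Var x * f) = (+) (Poly_Mapping.single x 1) ` Poly_Mapping.keys f"
proof
  show "Poly_Mapping.keys (Var x * f) \<subseteq> (+) (Poly_Mapping.single x 1) ` Poly_Mapping.keys f"
    using keys_mult[of "Var x" f] by (auto simp: Var_def)
qed (auto simp: in_keys_iff lookup_Var_mult[simplified])

text \<open>Regularity of a variable modulo the other ones: multiplying by \<open>Var x\<close>
  changes exponents at \<open>x\<close> only, so the variable from \<open>X\<close> that divides a
  monomial of the product already divides the monomial of \<open>f\<close>.\<close>

lemma var_ideal_cancel: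
  assumes "Var x * f \<in> var_ideal X" and "x \<notin> X"
  shows "f \<in> var_ideal X"
  unfolding var_ideal_def
proof safe
  fix m assume "m \<in> Poly_Mapping.keys f"
  hence "Poly_Mapping.single x 1 + m \<in> Poly_Mapping.keys (Var x * f)"
    unfolding keys_Var_mult by (rule imageI)
  then obtain y where "y \<in> X" and y: "Poly_Mapping.lookup (Poly_Mapping.single x 1 + m) y \<noteq> 0"
    using assms(1) unfolding var_ideal_def by blast
  with assms(2) have "x \<noteq> y" by blast
  with y have "Poly_Mapping.lookup m y \<noteq> 0" by (simp add: lookup_add lookup_single)
  with \<open>y \<in> X\<close> show "\<exists>x\<in>X. Poly_Mapping.lookup m x \<noteq> 0" by blast
qed

lemma var_ideal_insert_decomp:
  assumes "f \<in> var_ideal (insert x X)"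
  shows "\<exists>q. f - Var x * q \<in> var_ideal X"
proof -
  \<comment> \<open>Division by \<open>Var x\<close>: the coefficient of \<open>m\<close> in
    \<open>q\<close> is that of \<open>x m\<close> in \<open>f\<close>, so
    \<open>f - Var x * q\<close> keeps exactly the monomials free of \<open>x\<close>.\<close>
  define q where "q = Poly_Mapping.map_key ((+) (Poly_Mapping.single x 1)) f"
  have q: "Poly_Mapping.lookup q m = Poly_Mapping.lookup f (Poly_Mapping.single x 1 + m)" for m
    unfolding q_def by (subst map_key.rep_eq) auto
  have "\<exists>y\<in>X. Poly_Mapping.lookup m y \<noteq> 0"
    if m: "m \<in> Poly_Mapping.keys (f - Var x * q)" for m
  proof (cases "Poly_Mapping.lookup m x = 0")
    case True
    have "m \<notin> Poly_Mapping.keys (Var x * q)"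
      using True by (auto simp: keys_Var_mult lookup_add)
    hence "m \<in> Poly_Mapping.keys f" using m by (simp add: in_keys_iff lookup_minus)
    thus ?thesis using assms True unfolding var_ideal_def by auto
  next
    case False
    define m' where "m' = m - Poly_Mapping.single x 1"
    have "m = Poly_Mapping.single x 1 + m'"
      using False by (intro poly_mapping_eqI)
          (auto simp: m'_def lookup_add lookup_minus lookup_single when_def)
    hence "Poly_Mapping.lookup (f - Var x * q) m = 0"
      by (simp only: lookup_minus lookup_Var_mult q) simp
    with m show ?thesis by (simp add: in_keys_iff)
  qed
  thus ?thesis unfolding var_ideal_def by blast
qed

text \<open>
  A chain assigns a vector to every set of variables from the list \<open>xs\<close>; the set is encoded by its
  characteristic word. The complex is the iterated mapping cone of multiplication by the variables,
  which takes care of the signs.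
\<close>

fun koszul_diff :: "'n list \<Rightarrow> (bool list \<Rightarrow> ('n, 'k::field) fvec) \<Rightarrow> bool list \<Rightarrow> ('n, 'k) fvec"
  where
    "koszul_diff (x # xs) c (False # w)
        = koszul_diff xs (\<lambda>v. c (False # v)) w + smul (Var x) (c (True # w))"
  | "koszul_diff (x # xs) c (True # w) = - koszul_diff xs (\<lambda>v. c (True # v)) w"
  | "koszul_diff _ _ _ = 0"

abbreviation wt :: "bool list \<Rightarrow> int"
  where "wt w \<equiv> int (count_list w True)"

text \<open>Chains are defined on all words and vanish off the relevant ones. With an integer
  \<open>j\<close>, passing to \<open>j - 1\<close> needs no case distinction; for negative
  \<open>j\<close> only the zero chain is left.\<close>

definition koszul_chain :: "nat \<Rightarrow> int \<Rightarrow> (bool list \<Rightarrow> ('n, 'k::field) fvec) \<Rightarrow> bool"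
  where "koszul_chain n j c \<longleftrightarrow> (\<forall>w. c w \<noteq> 0 \<longrightarrow> length w = n \<and> wt w = j)"

lemma koszul_chainD: "koszul_chain n j c \<Longrightarrow> c w \<noteq> 0 \<Longrightarrow> length w = n \<and> wt w = j"
  unfolding koszul_chain_def by blast

lemma wt_eq_0_iff: "wt w = 0 \<longleftrightarrow> w = replicate (length w) False"
  by (induction w) auto

lemma wt_eq_length_iff: "wt w = int (length w) \<longleftrightarrow> w = replicate (length w) True"
proof (induction w)
  case (Cons b w)
  thus ?case using count_le_length[of w True] by auto
qed simp

lemma koszul_diff_Nil2 [simp]: "koszul_diff xs c [] = 0"
  by (cases xs) auto

text \<open>The differential is built from sums, signs and scalar multiples, so every linear map
  commutes with it. It is applied to multiplication by a variable, to truncation of coordinates and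
  to the maps of a resolution.\<close>

lemma koszul_diff_linear:
  assumes "\<And>u v. h (u + v) = h u + h v" and "\<And>f u. h (smul f u) = smul f (h u)"
  shows "koszul_diff xs (\<lambda>w. h (c w)) w = h (koszul_diff xs c w)"
proof -
  have h0: "h 0 = 0" using assms(1)[of 0 0] by simp
  have hm: "h (- u) = - h u" for u using assms(2)[of "- 1" u] by simp
  show ?thesis
    by (induction xs c w rule: koszul_diff.induct) (simp_all add: assms h0 hm)
qed

lemma koszul_diff_diff: "koszul_diff xs (\<lambda>w. c w - c' w) w = koszul_diff xs c w - koszul_diff xs c' w"
  by (induction xs c w arbitrary: c' rule: koszul_diff.induct)
      (simp_all add: fvec.scale_right_diff_distrib)

lemma koszul_diff_add: "koszul_diff xs (\<lambda>w. c w + c' w) w = koszul_diff xs c w + koszul_diff xs c' w"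
  by (induction xs c w arbitrary: c' rule: koszul_diff.induct) (simp_all add: fvec.scale_right_distrib)

lemma koszul_diff_zero [simp]: "koszul_diff xs (\<lambda>w. 0) w = 0"
  using koszul_diff_diff[of xs "\<lambda>_. 0" "\<lambda>_. 0" w] by simp

lemma koszul_diff_in_subspace:
  assumes "fvec.subspace N" and "\<And>w. c w \<in> N"
  shows "koszul_diff xs c w \<in> N"
  using assms(2)
  by (induction xs c w rule: koszul_diff.induct)
    (simp_all add: fvec.subspace_add[OF assms(1)] fvec.subspace_scale[OF assms(1)]
      fvec.subspace_neg[OF assms(1)] fvec.subspace_0[OF assms(1)])

lemma koszul_diff_uminus: "koszul_diff xs (\<lambda>w. - c w) w = - koszul_diff xs c w"
  using koszul_diff_diff[of xs "\<lambda>_. 0" c w] by simp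

text \<open>The minus sign on the \<open>True\<close> component makes the two mixed terms,
  \<open>Var x\<close> times the boundary of that component, cancel.\<close>

lemma koszul_diff_koszul_diff: "koszul_diff xs (koszul_diff xs c) w = 0"
proof (induction xs arbitrary: c w)
  case (Cons x xs)
  show ?case
  proof (cases w)
    case (Cons b v)
    have 2: "koszul_diff xs (\<lambda>v. smul (Var x) (c (True # v))) v
        = smul (Var x) (koszul_diff xs (\<lambda>v. c (True # v)) v)"
      by (rule koszul_diff_linear) (simp_all add: fvec.scale_right_distrib mult.commute)
    show ?thesis
      using Cons Cons.IH by (cases b) (simp_all add: 2 koszul_diff_uminus koszul_diff_add)
  qed simp
qed (cases w, simp_all)

lemma koszul_chain_Cons:
  assumes "koszul_chain (Suc n) j c"
  shows "koszul_chain n j (\<lambda>v. c (False # v))" and "koszul_chain n (j - 1) (\<lambda>v. c (True # v))"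
proof -
  have *: "c (b # v) \<noteq> 0 \<Longrightarrow> length (b # v) = Suc n \<and> wt (b # v) = j" for b v
    using assms unfolding koszul_chain_def by blast
  show "koszul_chain n j (\<lambda>v. c (False # v))"
    using *[of False] by (simp add: koszul_chain_def)
  show "koszul_chain n (j - 1) (\<lambda>v. c (True # v))"
    unfolding koszul_chain_def
  proof (intro allI impI)
    fix v assume "c (True # v) \<noteq> 0"
    from *[OF this] show "length v = n \<and> wt v = j - 1" by simp
  qed
qed

lemma koszul_chain_koszul_diff:
  "koszul_chain (length xs) j c \<Longrightarrow> koszul_chain (length xs) (j - 1) (koszul_diff xs c)"
proof (induction xs arbitrary: c j)
  case (Cons x xs)
  note c = koszul_chain_Cons[OF Cons.prems[simplified]]
  note IH = Cons.IH[OF c(1)] Cons.IH[OF c(2)]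
  show ?case unfolding koszul_chain_def
  proof safe
    fix w assume *: "koszul_diff (x # xs) c w \<noteq> 0"
    then obtain b v where w: "w = b # v" by (cases w) auto
    have "length v = length xs \<and> wt v = (if b then j - 2 else j - 1)"
    proof (cases b)
      case True
      with * have "koszul_diff xs (\<lambda>v. c (True # v)) v \<noteq> 0" by (simp add: w)
      thus ?thesis using True IH(2) unfolding koszul_chain_def by auto
    next
      case False
      with * have "koszul_diff xs (\<lambda>v. c (False # v)) v \<noteq> 0 \<or> c (True # v) \<noteq> 0" by (auto simp: w)
      thus ?thesis using False IH(1) c(2) unfolding koszul_chain_def by auto
    qed
    thus "length w = length (x # xs)" "wt w = j - 1" by (simp_all add: w)
  qed
qed (simp add: koszul_chain_def)

definition koszul_pair :: "(bool list \<Rightarrow> ('n, 'k::field) fvec) \<Rightarrow> (bool list \<Rightarrow> ('n, 'k) fvec)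
    \<Rightarrow> bool list \<Rightarrow> ('n, 'k) fvec"
  where "koszul_pair c c' w = (case w of [] \<Rightarrow> 0 | b # v \<Rightarrow> if b then c' v else c v)"

lemma koszul_pair_Cons [simp]: "koszul_pair c c' (False # v) = c v" "koszul_pair c c' (True # v) = c' v"
  by (simp_all add: koszul_pair_def)

lemma koszul_chain_koszul_pair:
  "koszul_chain n j c \<Longrightarrow> koszul_chain n (j - 1) c' \<Longrightarrow> koszul_chain (Suc n) j (koszul_pair c c')"
  unfolding koszul_chain_def koszul_pair_def by (auto split: list.splits)

text \<open>Peeling one variable after another off every coordinate leaves quotients that serve as
  components on the words with a single \<open>True\<close>. Together with
  \<open>koszul_diff_var_ideal\<close> this determines the image of the first differential, hence
  H_0.\<close>

lemma koszul_chain_top_of_var_ideal: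
  assumes "\<And>k. v k \<in> var_ideal (set xs)"
  shows "\<exists>c. koszul_chain (length xs) 1 c \<and> koszul_diff xs c (replicate (length xs) False) = v"
  using assms
proof (induction xs arbitrary: v)
  case Nil
  hence "v = 0" by (auto simp: fun_eq_iff var_ideal_def fvec_apply)
  thus ?case by (intro exI[of _ "\<lambda>_. 0"]) (simp add: koszul_chain_def)
next
  case (Cons x xs)
  have "\<forall>k. \<exists>q. v k - Var x * q \<in> var_ideal (set xs)"
    using Cons.prems by (intro allI var_ideal_insert_decomp) simp
  then obtain q where q: "\<And>k. v k - Var x * q k \<in> var_ideal (set xs)" by metis
  have "\<exists>c. koszul_chain (length xs) 1 c \<and>
      koszul_diff xs c (replicate (length xs) False) = v - smul (Var x) q"
    by (rule Cons.IH) (unfold fvec_apply, rule q)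
  then obtain c where
    c: "koszul_chain (length xs) 1 c" "koszul_diff xs c (replicate (length xs) False)
        = v - smul (Var x) q"
    by blast
  define c' where "c' w = (if w = replicate (length xs) False then q else 0)" for w
  have "koszul_chain (length xs) (1 - 1) c'"
    unfolding koszul_chain_def c'_def using wt_eq_0_iff by simp
  from koszul_chain_koszul_pair[OF c(1) this] show ?case
    using c by (intro exI[of _ "koszul_pair c c'"]) (simp add: c'_def)
qed

lemma var_ideal_subspace: "ideals.subspace (var_ideal X)"
  by (intro ideals.subspaceI) (auto intro: var_ideal_add var_ideal_mult)

lemma koszul_diff_var_ideal: "koszul_diff xs c w k \<in> var_ideal (set xs)"
proof (induction xs c w rule: koszul_diff.induct)
  case (1 x xs c w)
  have "c (True # w) k * Var x \<in> var_ideal (insert x (set xs))"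
    by (rule var_ideal_mult, rule var_ideal_Var) simp
  moreover have "koszul_diff xs (\<lambda>v. c (False # v)) w k \<in> var_ideal (insert x (set xs))"
    by (rule var_ideal_mono[OF 1]) auto
  ultimately show ?case by (simp add: fvec_apply var_ideal_add mult.commute)
next
  case (2 x xs c w)
  have "koszul_diff xs (\<lambda>v. c (True # v)) w k \<in> var_ideal (insert x (set xs))"
    by (rule var_ideal_mono[OF 2]) auto
  thus ?case by (simp add: fvec_apply)
qed (simp_all add: fvec_apply)

text \<open>
  By induction along the mapping cones: a cycle \<open>(c\<^sub>0, c\<^sub>1)\<close> satisfies \<open>d c\<^sub>0 = - x c\<^sub>1\<close> and
  \<open>d c\<^sub>1 = 0\<close>. If \<open>c\<^sub>1\<close> has degree 0 it is a boundary because \<open>x\<close> is regular modulo the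
  other variables.
\<close>

theorem koszul_diff_acyclic:
  assumes "distinct xs" and "koszul_chain (length xs) j c" and "j \<ge> 1" and "koszul_diff xs c = (\<lambda>_. 0)"
  shows "\<exists>a. koszul_chain (length xs) (j + 1) a \<and> koszul_diff xs a = c"
  using assms
proof (induction xs arbitrary: c j)
  case Nil
  have "c w = 0" for w
  proof (rule ccontr)
    assume "c w \<noteq> 0"
    from koszul_chainD[OF Nil(2) this] Nil(3) show False by auto
  qed
  hence "c = (\<lambda>_. 0)" by (rule ext)
  thus ?case by (intro exI[of _ "\<lambda>_. 0"]) (simp add: koszul_chain_def fun_eq_iff)
next
  case (Cons x xs)
  define c0 where "c0 = (\<lambda>v. c (False # v))"
  define c1 where "c1 = (\<lambda>v. c (True # v))"
  note ch = koszul_chain_Cons[OF Cons.prems(2)[simplified], folded c0_def c1_def]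
  have d1: "koszul_diff xs c1 v = 0" for v
    using fun_cong[OF Cons.prems(4), of "True # v"] by (simp add: c1_def)
  have d0: "koszul_diff xs c0 v = - smul (Var x) (c1 v)" for v
    unfolding eq_neg_iff_add_eq_0
    using fun_cong[OF Cons.prems(4), of "False # v"] by (simp add: c0_def c1_def)
  have "\<exists>b. koszul_chain (length xs) j b \<and> koszul_diff xs b = c1"
  proof (cases "j = 1")
    case False
    have "\<exists>a. koszul_chain (length xs) (j - 1 + 1) a \<and> koszul_diff xs a = c1"
    proof (rule Cons.IH)
      show "distinct xs" "j - 1 \<ge> 1" using False Cons.prems(1,3) by simp_all
      show "koszul_diff xs c1 = (\<lambda>_. 0)" by (rule ext) (rule d1)
    qed (rule ch)
    thus ?thesis by simp
  next
    case True
    \<comment> \<open>\<open>z\<close> is the only word of weight 0, so \<open>c1\<close> lives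
      there alone, and \<open>d0\<close> puts \<open>Var x\<close> times its value into the ideal of
      the other variables.\<close>
    define z where "z = replicate (length xs) False"
    have "Var x * c1 z k = - koszul_diff xs c0 z k" for k
      by (simp add: d0 fvec_apply)
    hence "Var x * c1 z k \<in> var_ideal (set xs)" for k by (simp add: koszul_diff_var_ideal)
    hence "c1 z k \<in> var_ideal (set xs)" for k
      by (rule var_ideal_cancel) (use Cons.prems(1) in simp)
    from koszul_chain_top_of_var_ideal[of "c1 z", OF this] obtain b
      where b: "koszul_chain (length xs) 1 b" "koszul_diff xs b z = c1 z" unfolding z_def by blast
    have "koszul_diff xs b w = c1 w" for w
    proof (cases "w = z")
      case False
      hence "\<not> (length w = length xs \<and> wt w = 0)"
        unfolding z_def using wt_eq_0_iff[of w] by auto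
      hence "c1 w = 0" "koszul_diff xs b w = 0"
        using ch(2) koszul_chain_koszul_diff[OF b(1)] True unfolding koszul_chain_def by auto
      thus ?thesis by simp
    qed (simp add: b)
    hence "koszul_diff xs b = c1" by (rule ext)
    with b(1) True show ?thesis by blast
  qed
  then obtain b where b: "koszul_chain (length xs) j b" "koszul_diff xs b = c1" by blast
  have sb: "koszul_diff xs (\<lambda>v. smul (Var x) (b v)) w = smul (Var x) (koszul_diff xs b w)" for w
    by (rule koszul_diff_linear) (simp_all add: fvec.scale_right_distrib mult.commute)
  \<comment> \<open>As \<open>b\<close> bounds \<open>c1\<close>, the chain \<open>c0 + x b\<close>
    is a cycle for the remaining variables. If \<open>a\<close> bounds it, then the pair of
    \<open>a\<close> and \<open>- b\<close> bounds \<open>c\<close>.\<close>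
  have ch_sum: "koszul_chain (length xs) j (\<lambda>v. c0 v + smul (Var x) (b v))"
    unfolding koszul_chain_def
  proof (intro allI impI)
    fix v assume "c0 v + smul (Var x) (b v) \<noteq> 0"
    hence "c0 v \<noteq> 0 \<or> b v \<noteq> 0" by auto
    thus "length v = length xs \<and> wt v = j" using ch(1) b(1) unfolding koszul_chain_def by blast
  qed
  have "koszul_diff xs (\<lambda>v. c0 v + smul (Var x) (b v)) = (\<lambda>_. 0)"
    by (rule ext) (simp add: koszul_diff_add sb d0 b)
  from Cons.IH[OF _ ch_sum Cons.prems(3) this] Cons.prems(1) obtain a
    where a: "koszul_chain (length xs) (j + 1) a" "koszul_diff xs a = (\<lambda>v. c0 v + smul (Var x) (b v))"
    unfolding distinct.simps by blast
  define a' where "a' = koszul_pair a (\<lambda>v. 0 - b v)"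
  have "koszul_chain (length (x # xs)) (j + 1) a'"
    using a(1) b(1) unfolding a'_def length_Cons
    by (intro koszul_chain_koszul_pair) (simp_all add: koszul_chain_def)
  moreover have "koszul_diff (x # xs) a' w = c w" for w
  proof (cases w)
    case Nil
    have "c [] = 0" using koszul_chainD[OF Cons.prems(2), of "[]"] by auto
    with Nil show ?thesis by simp
  next
    case (Cons e v)
    thus ?thesis by (cases e)
        (simp_all add: a'_def a koszul_diff_uminus b c0_def c1_def fvec.scale_right_diff_distrib)
  qed
  hence "koszul_diff (x # xs) a' = c" by (rule ext)
  ultimately show ?case by blast
qed

text \<open>Cycles of top degree modulo \<open>N\<close> are the socle elements of the quotient by \<open>N\<close>.\<close>

lemma koszul_diff_top:
  assumes "fvec.subspace N" and "koszul_chain (length xs) (int (length xs)) c"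
  shows "(\<forall>w. koszul_diff xs c w \<in> N) \<longleftrightarrow>
    (\<forall>x\<in>set xs. smul (Var x) (c (replicate (length xs) True)) \<in> N)"
  using assms(2)
proof (induction xs arbitrary: c)
  case Nil
  thus ?case using fvec.subspace_0[OF assms(1)] by simp
next
  case (Cons x xs)
  define c1 where "c1 = (\<lambda>v. c (True # v))"
  have le: "count_list w True \<le> length w" for w :: "bool list" by (rule count_le_length)
  \<comment> \<open>A word of top weight consists of \<open>True\<close> only, so the component at
    \<open>False\<close> is zero and contributes nothing to the boundary.\<close>
  have c0: "c (False # v) = 0" for v
  proof (rule ccontr)
    assume "c (False # v) \<noteq> 0"
    hence "length (False # v) = length (x # xs) \<and> wt (False # v) = int (length (x # xs))"
      using Cons.prems unfolding koszul_chain_def by blast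
    with le[of v] show False by simp
  qed
  have c1: "koszul_chain (length xs) (int (length xs)) c1"
    using koszul_chain_Cons(2)[OF Cons.prems[simplified]] by (simp add: c1_def)
  have cz: "c1 v = 0" if "v \<noteq> replicate (length xs) True" for v
  proof (rule ccontr)
    assume "c1 v \<noteq> 0"
    from koszul_chainD[OF c1 this] have "length v = length xs" "wt v = int (length v)" by simp_all
    with that show False by (metis wt_eq_length_iff)
  qed
  have F: "koszul_diff (x # xs) c (False # v) = smul (Var x) (c1 v)" for v by (simp add: c0 c1_def)
  have T: "koszul_diff (x # xs) c (True # v) = - koszul_diff xs c1 v" for v by (simp add: c1_def)
  have "(\<forall>w. koszul_diff (x # xs) c w \<in> N) \<longleftrightarrow> (\<forall>v. smul (Var x) (c1 v) \<in> N)
      \<and> (\<forall>v. - koszul_diff xs c1 v \<in> N)"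
  proof (intro iffI conjI allI)
    fix w assume *: "(\<forall>v. smul (Var x) (c1 v) \<in> N) \<and> (\<forall>v. - koszul_diff xs c1 v \<in> N)"
    show "koszul_diff (x # xs) c w \<in> N"
    proof (cases w)
      case (Cons b v)
      thus ?thesis using * by (cases b) (simp_all only: F T)
    qed (simp add: fvec.subspace_0[OF assms(1)])
  qed (metis F, metis T)
  also have "(\<forall>v. - koszul_diff xs c1 v \<in> N) \<longleftrightarrow> (\<forall>v. koszul_diff xs c1 v \<in> N)"
    using fvec.subspace_neg[OF assms(1)] by (metis minus_minus)
  also have "(\<forall>v. smul (Var x) (c1 v) \<in> N) \<longleftrightarrow> smul (Var x) (c1 (replicate (length xs) True)) \<in> N"
  proof safe
    fix v assume *: "smul (Var x) (c1 (replicate (length xs) True)) \<in> N"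
    show "smul (Var x) (c1 v) \<in> N"
      using * cz[of v] fvec.subspace_0[OF assms(1)]
      by (cases "v = replicate (length xs) True") simp_all
  qed blast
  finally show ?case using Cons.IH[OF c1] by (simp add: c1_def)
qed

section \<open>Koszul homology of graded modules\<close>

definition free_module :: "int list \<Rightarrow> ('n, 'k::field) fvec set"
  where "free_module s = {v. \<forall>k\<ge>length s. v k = 0}"

definition graded_part :: "int list \<Rightarrow> int \<Rightarrow> ('n::finite, 'k::field) fvec set"
  where "graded_part s t = {v \<in> free_module s. \<forall>k<length s. homogeneous (t - s ! k) (v k)}"

text \<open>The \<open>k\<close>-th basis vector has degree \<open>s ! k\<close>, hence the offset.
  Coordinates beyond the rank are cut off, so the result lies in the free module for every
  argument.\<close>

definition graded_proj :: "int list \<Rightarrow> int \<Rightarrow> ('n::finite, 'k::field) fvec \<Rightarrow> ('n, 'k) fvec"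
  where "graded_proj s t v = (\<lambda>k. if k < length s then hom_comp (t - s ! k) (v k) else 0)"

lemma graded_proj_apply:
  "graded_proj s t v k = (if k < length s then hom_comp (t - s ! k) (v k) else 0)"
  by (simp add: graded_proj_def)

lemma free_module_subspace: "fvec.subspace (free_module s)"
  by (intro fvec.subspaceI) (simp_all add: free_module_def fvec_apply)

lemmas free_module_closed =
  fvec.subspace_0[OF free_module_subspace] fvec.subspace_add[OF free_module_subspace]
  fvec.subspace_diff[OF free_module_subspace] fvec.subspace_scale[OF free_module_subspace]

lemma graded_part_free_module: "v \<in> graded_part s t \<Longrightarrow> v \<in> free_module s"
  by (simp add: graded_part_def)

lemma graded_proj_graded_part: "graded_proj s t v \<in> graded_part s t"
  by (simp add: graded_part_def free_module_def graded_proj_apply)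

lemma graded_proj_id: "v \<in> graded_part s t \<Longrightarrow> graded_proj s t v = v"
  by (rule ext) (simp add: graded_part_def free_module_def graded_proj_apply hom_comp_id_iff)

lemma graded_proj_0 [simp]: "graded_proj s t 0 = 0"
  by (rule ext) (simp add: graded_proj_apply fvec_apply)

lemma graded_proj_add: "graded_proj s t (u + v) = graded_proj s t u + graded_proj s t v"
  by (rule ext) (simp add: graded_proj_apply fvec_apply hom_comp_add)

lemma graded_proj_uminus: "graded_proj s t (- v) = - graded_proj s t v"
  by (rule ext) (simp add: graded_proj_apply fvec_apply hom_comp_uminus)

lemma graded_proj_diff: "graded_proj s t (u - v) = graded_proj s t u - graded_proj s t v"
  by (rule ext) (simp add: graded_proj_apply fvec_apply hom_comp_diff)

lemma graded_proj_smul: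
  "homogeneous d f \<Longrightarrow> graded_proj s t (smul f v) = smul f (graded_proj s (t - d) v)"
  by (rule ext) (simp add: graded_proj_apply fvec_apply hom_comp_mult algebra_simps)

lemma graded_part_closed:
  "0 \<in> graded_part s t" "u \<in> graded_part s t \<Longrightarrow> v \<in> graded_part s t \<Longrightarrow> u - v \<in> graded_part s t"
proof -
  show "0 \<in> graded_part s t" using graded_proj_graded_part[of s t 0] by simp
  show "u - v \<in> graded_part s t" if "u \<in> graded_part s t" "v \<in> graded_part s t"
    using graded_proj_graded_part[of s t "u - v"] that by (simp add: graded_proj_diff graded_proj_id)
qed

lemma sum_fun_apply: "sum f D k = (\<Sum>t\<in>D. f t k)" for f :: "'a \<Rightarrow> ('n, 'k::field) fvec"
  by (induction D rule: infinite_finite_induct) (simp_all add: fvec_apply)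

lemma sum_graded_proj:
  assumes "v \<in> free_module s"
  shows "\<exists>D. finite D \<and> v = (\<Sum>t\<in>D. graded_proj s t v)"
proof -
  \<comment> \<open>The degrees that occur in \<open>v\<close>: a monomial in coordinate
    \<open>k\<close> is counted with the degree \<open>s ! k\<close> of the basis vector.\<close>
  define D where "D = (\<Union>k<length s. (\<lambda>m. int (mono_deg m) + s ! k) ` Poly_Mapping.keys (v k))"
  have D: "finite D" by (simp add: D_def)
  have "(\<Sum>t\<in>D. graded_proj s t v) k = v k" for k
  proof (cases "k < length s")
    case True
    have "(\<Sum>t\<in>D. graded_proj s t v) k = (\<Sum>t\<in>D. hom_comp (t - s ! k) (v k))"
      using True by (simp add: sum_fun_apply graded_proj_apply)
    also have "\<dots> = (\<Sum>t\<in>(\<lambda>t. t - s ! k) ` D. hom_comp t (v k))"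
      by (subst sum.reindex) (simp_all add: inj_on_def)
    also have "\<dots> = v k"
    proof (rule sum_hom_comp)
      fix m assume "m \<in> Poly_Mapping.keys (v k)"
      hence "int (mono_deg m) + s ! k \<in> D" using True unfolding D_def by blast
      thus "int (mono_deg m) \<in> (\<lambda>t. t - s ! k) ` D" by (rule rev_image_eqI) simp
    qed (simp add: D)
    finally show ?thesis .
  next
    case False
    thus ?thesis using assms by (simp add: sum_fun_apply graded_proj_apply free_module_def)
  qed
  hence "(\<Sum>t\<in>D. graded_proj s t v) = v" by (rule ext)
  with D show ?thesis by metis
qed

text \<open>The basis element of the Koszul complex at \<open>w\<close> has degree
  \<open>wt w\<close>, so a chain of internal degree \<open>t\<close> has a coefficient of degree
  \<open>t - wt w\<close> there. With this grading the differential preserves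
  \<open>t\<close>.\<close>

lemma koszul_diff_graded_proj:
  "koszul_diff xs (\<lambda>w. graded_proj s (t - wt w) (c w)) w
      = graded_proj s (t - wt w) (koszul_diff xs c w)"
proof (induction xs c w arbitrary: t rule: koszul_diff.induct)
  case (1 x xs c w)
  from 1[of t] show ?case
    by (simp add: graded_proj_add graded_proj_smul[OF homogeneous_Var] algebra_simps)
next
  case (2 x xs c w)
  from 2[of "t - 1"] show ?case by (simp add: graded_proj_uminus algebra_simps)
qed simp_all

lemma koszul_diff_graded_part:
  assumes "\<And>w. c w \<in> graded_part s (t - wt w)"
  shows "koszul_diff xs c w \<in> graded_part s (t - wt w)"
proof -
  have "(\<lambda>w. graded_proj s (t - wt w) (c w)) = c" by (rule ext) (rule graded_proj_id[OF assms])
  with koszul_diff_graded_proj[of xs s t c w] have "koszul_diff xs c w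
      = graded_proj s (t - wt w) (koszul_diff xs c w)"
    by simp
  thus ?thesis using graded_proj_graded_part[of s "t - wt w" "koszul_diff xs c w"] by simp
qed

lemma koszul_chain_graded_proj:
  "koszul_chain n j c \<Longrightarrow> koszul_chain n j (\<lambda>w. graded_proj s (t - wt w) (c w))"
  unfolding koszul_chain_def by (metis graded_proj_0)

section \<open>Graded submodules and the Koszul complex in all variables\<close>

definition graded_sub :: "int list \<Rightarrow> ('n::finite, 'k::field) fvec set \<Rightarrow> bool"
  where "graded_sub s N \<longleftrightarrow> fvec.subspace N \<and> N \<subseteq> free_module s \<and> (\<forall>v\<in>N. \<forall>t. graded_proj s t v \<in> N)"

definition var_list :: "'n::finite list"
  where "var_list = (SOME xs. distinct xs \<and> set xs = UNIV)"

lemma var_list: "distinct (var_list :: 'n::finite list)" "set (var_list :: 'n list) = UNIV"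
proof -
  have "\<exists>xs :: 'n list. distinct xs \<and> set xs = UNIV"
    using finite_distinct_list[of "UNIV :: 'n set"] by auto
  from someI_ex[OF this] show "distinct (var_list :: 'n list)" "set (var_list :: 'n list) = UNIV"
    by (simp_all add: var_list_def)
qed

lemma length_var_list: "length (var_list :: 'n::finite list) = card (UNIV :: 'n set)"
proof -
  have "distinct (var_list :: 'n list)" by (rule var_list)
  from distinct_card[OF this] show ?thesis by (simp add: var_list(2))
qed

abbreviation chain :: "int \<Rightarrow> (bool list \<Rightarrow> ('n::finite, 'k::field) fvec) \<Rightarrow> bool"
  where "chain \<equiv> koszul_chain (length (var_list :: 'n list))"

abbreviation boundary :: "(bool list \<Rightarrow> ('n::finite, 'k::field) fvec) \<Rightarrow> bool list \<Rightarrow> ('n, 'k) fvec"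
  where "boundary \<equiv> koszul_diff var_list"

text \<open>Vanishing of \<open>H\<^sub>j(x\<^sub>1, \<dots>, x\<^sub>n; F/N)\<close> in degree \<open>t\<close>, where \<open>F\<close> is free with shifts \<open>s\<close>.\<close>

definition koszul_vanishes :: "int list \<Rightarrow> ('n::finite, 'k::field) fvec set \<Rightarrow> int \<Rightarrow> int \<Rightarrow> bool"
  where "koszul_vanishes s N j t \<longleftrightarrow>
    (\<forall>c. chain j c \<and> (\<forall>w. c w \<in> graded_part s (t - wt w)) \<and> (\<forall>w. boundary c w \<in> N) \<longrightarrow>
      (\<exists>a. chain (j + 1) a \<and> (\<forall>w. a w \<in> free_module s) \<and> (\<forall>w. c w - boundary a w \<in> N)))"

lemma koszul_vanishesD:
  assumes "koszul_vanishes s N j t" "chain j c" "\<And>w. c w \<in> graded_part s (t - wt w)" "\<And>w. boundary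
      c w \<in> N"
  obtains a where "chain (j + 1) a" "\<And>w. a w \<in> free_module s" "\<And>w. c w - boundary a w \<in> N"
  using assms unfolding koszul_vanishes_def by blast

lemma boundary_acyclic:
  assumes "chain j c" "j \<ge> 1" "\<And>w. boundary c w = 0" "\<And>w. c w \<in> free_module s"
  obtains a where "chain (j + 1) a" "\<And>w. a w \<in> free_module s" "\<And>w. boundary a w = c w"
proof -
  have "boundary c = (\<lambda>_. 0)" by (rule ext) (rule assms)
  from koszul_diff_acyclic[OF var_list(1) assms(1,2) this] obtain a
      where a: "chain (j + 1) a" "boundary a = c"
    by blast
  \<comment> \<open>The primitive \<open>a\<close> may have coordinates beyond the rank. Cutting
    them off is linear and fixes \<open>c\<close>, so it does not disturb the boundary.\<close>
  define h :: "('a, 'b) fvec \<Rightarrow> ('a, 'b) fvec"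
    where "h v = (\<lambda>k. if k < length s then v k else 0)" for v
  have h: "h v \<in> free_module s" "v \<in> free_module s \<Longrightarrow> h v = v" "h 0 = 0" for v
    by (auto simp: h_def free_module_def fun_eq_iff fvec_apply)
  have "boundary (\<lambda>w. h (a w)) w = h (boundary a w)" for w
    by (rule koszul_diff_linear) (simp_all add: h_def fun_eq_iff fvec_apply)
  hence "boundary (\<lambda>w. h (a w)) w = c w" for w by (simp add: a(2) h(2)[OF assms(4)])
  moreover have "chain (j + 1) (\<lambda>w. h (a w))"
    using a(1) h(3) unfolding koszul_chain_def by metis
  ultimately show ?thesis using that[of "\<lambda>w. h (a w)"] h(1) by blast
qed

section \<open>Homomorphisms of graded free modules and the shift of Koszul homology\<close>

locale graded_hom =
  fixes s' s :: "int list" and \<phi> :: "('n::finite, 'k::field) fvec \<Rightarrow> ('n, 'k) fvec"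
  assumes add: "\<phi> (u + v) = \<phi> u + \<phi> v"
    and scale: "\<phi> (smul f u) = smul f (\<phi> u)"
    and free_module: "\<phi> v \<in> free_module s"
    and graded_proj: "v \<in> free_module s' \<Longrightarrow> \<phi> (graded_proj s' t v) = graded_proj s t (\<phi> v)"
begin

lemma zero: "\<phi> 0 = 0"
  using scale[of 0 0] by simp

lemma uminus: "\<phi> (- u) = - \<phi> u"
  using scale[of "- 1" u] by simp

lemma diff: "\<phi> (u - v) = \<phi> u - \<phi> v"
  using add[of u "- v"] by (simp add: uminus)

lemma koszul_diff: "koszul_diff xs (\<lambda>w. \<phi> (c w)) w = \<phi> (koszul_diff xs c w)"
  by (rule koszul_diff_linear) (rule add scale)+

abbreviation im where "im \<equiv> \<phi> ` free_module s'"
abbreviation ker where "ker \<equiv> {v \<in> free_module s'. \<phi> v = 0}"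

lemma graded_sub_im: "graded_sub s im"
  unfolding graded_sub_def
proof (intro conjI ballI allI)
  show "fvec.subspace im"
  proof (rule fvec.subspaceI)
    show "0 \<in> im" using zero free_module_closed(1) by (metis image_eqI)
  next
    fix x y assume "x \<in> im" "y \<in> im"
    then obtain u v where "u \<in> free_module s'" "v \<in> free_module s'" "x = \<phi> u" "y = \<phi> v" by blast
    thus "x + y \<in> im" using add free_module_closed(2) by (metis image_eqI)
  next
    fix f x assume "x \<in> im"
    then obtain u where "u \<in> free_module s'" "x = \<phi> u" by blast
    thus "smul f x \<in> im" using scale free_module_closed(4) by (metis image_eqI)
  qed
  show "im \<subseteq> free_module s" using free_module by blast
  fix v t assume "v \<in> im"
  then obtain u where "u \<in> free_module s'" "v = \<phi> u" by blast
  thus "graded_proj s t v \<in> im"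
    using graded_proj graded_proj_graded_part graded_part_free_module by (metis image_eqI)
qed

lemma graded_sub_ker: "graded_sub s' ker"
  unfolding graded_sub_def
proof (intro conjI ballI allI)
  show "fvec.subspace ker"
    by (rule fvec.subspaceI) (simp_all add: free_module_closed zero add scale)
  fix v t assume "v \<in> ker"
  thus "graded_proj s' t v \<in> ker"
    using graded_part_free_module[OF graded_proj_graded_part[of s' t v]] by (simp add: graded_proj)
qed blast

lemma lift:
  assumes "chain j c" "\<And>w. c w \<in> im"
  obtains b where "chain j b" "\<And>w. b w \<in> free_module s'" "\<And>w. \<phi> (b w) = c w"
proof -
  have "\<forall>w. \<exists>b. b \<in> free_module s' \<and> \<phi> b = c w" using assms(2) by (metis imageE)
  then obtain b where b: "\<And>w. b w \<in> free_module s'" "\<And>w. \<phi> (b w) = c w" by metis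
  \<comment> \<open>A chosen preimage of 0 could be nonzero; it is replaced by 0 to keep the lift a
    chain.\<close>
  define b' where "b' w = (if c w = 0 then 0 else b w)" for w
  have "chain j b'" unfolding koszul_chain_def
  proof (intro allI impI)
    fix w assume "b' w \<noteq> 0"
    hence "c w \<noteq> 0" by (auto simp: b'_def)
    with assms(1) show "length w = length (var_list :: 'n list) \<and> wt w = j" by (rule koszul_chainD)
  qed
  moreover have "b' w \<in> free_module s'" "\<phi> (b' w) = c w" for w
    using b by (simp_all add: b'_def zero free_module_closed)
  ultimately show ?thesis by (rule that)
qed

lemma chain_image: "chain j c \<Longrightarrow> chain j (\<lambda>w. \<phi> (c w))"
  unfolding koszul_chain_def by (metis zero)

lemma graded_part_image: "v \<in> graded_part s' t \<Longrightarrow> \<phi> v \<in> graded_part s t"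
  by (metis graded_proj graded_proj_id graded_proj_graded_part graded_part_free_module)

text \<open>This uses the connecting map: the boundary of \<open>c\<close> lifts to a chain
  \<open>b\<close>, which is a cycle modulo the kernel because boundaries square to zero. If
  \<open>b\<close> is the boundary of \<open>a'\<close> modulo the kernel, then \<open>c\<close>
  minus the image of \<open>a'\<close> is an honest cycle in a free module, hence a
  boundary.\<close>

lemma koszul_vanishes_im:
  assumes "koszul_vanishes s' ker (j - 1) t" and "j \<ge> 1"
  shows "koszul_vanishes s im j t"
  unfolding koszul_vanishes_def
proof (intro allI impI, elim conjE)
  fix c :: "bool list \<Rightarrow> ('n, 'k) fvec"
  assume c: "chain j c" "\<forall>w. c w \<in> graded_part s (t - wt w)" "\<forall>w. boundary c w \<in> im"
  obtain b0 where b0: "chain (j - 1) b0" "\<And>w. b0 w \<in> free_module s'" "\<And>w. \<phi> (b0 w) = boundary c w"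
    using lift[OF koszul_chain_koszul_diff[OF c(1)]] c(3) by blast
  \<comment> \<open>An arbitrary lift need not be homogeneous. Its projection is, and has the same
    image, since the boundary of \<open>c\<close> already has internal degree
    \<open>t\<close>.\<close>
  define b where "b w = graded_proj s' (t - wt w) (b0 w)" for w
  have b: "chain (j - 1) b" "b w \<in> graded_part s' (t - wt w)" "\<phi> (b w) = boundary c w" for w
  proof -
    show "chain (j - 1) b" unfolding b_def by (rule koszul_chain_graded_proj[OF b0(1)])
    show "b w \<in> graded_part s' (t - wt w)" unfolding b_def by (rule graded_proj_graded_part)
    have "\<phi> (b w) = graded_proj s (t - wt w) (boundary c w)"
      by (simp add: b_def graded_proj[OF b0(2)] b0(3))
    also have "\<dots> = boundary c w"
      by (rule graded_proj_id, rule koszul_diff_graded_part) (use c(2) in blast)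
    finally show "\<phi> (b w) = boundary c w" .
  qed
  have "boundary b w \<in> ker" for w
  proof -
    have "\<phi> (boundary b w) = 0" by (simp add: koszul_diff[symmetric] b(3) koszul_diff_koszul_diff)
    moreover have "boundary b w \<in> free_module s'"
      by (rule koszul_diff_in_subspace[OF free_module_subspace]) (rule graded_part_free_module[OF b(2)])
    ultimately show ?thesis by simp
  qed
  from koszul_vanishesD[OF assms(1) b(1,2) this] obtain a' where
    a': "chain (j - 1 + 1) a'" "\<And>w. a' w \<in> free_module s'" "\<And>w. b w - boundary a' w \<in> ker" by blast
  define c' where "c' w = c w - \<phi> (a' w)" for w
  have "chain j c'" unfolding koszul_chain_def
  proof (intro allI impI)
    fix w assume "c' w \<noteq> 0"
    hence "c w \<noteq> 0 \<or> a' w \<noteq> 0" by (auto simp: c'_def zero)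
    thus "length w = length (var_list :: 'n list) \<and> wt w = j"
      using koszul_chainD[OF c(1)] koszul_chainD[OF a'(1)] by auto
  qed
  moreover have "boundary c' w = 0" for w
  proof -
    have "\<phi> (b w) = \<phi> (boundary a' w)" using a'(3)[of w] by (simp add: diff)
    thus ?thesis by (simp add: c'_def[abs_def] koszul_diff_diff koszul_diff b(3))
  qed
  moreover have "c' w \<in> free_module s" for w
    unfolding c'_def using c(2) free_module_closed(3) free_module graded_part_free_module by blast
  ultimately obtain a where
    a: "chain (j + 1) a" "\<And>w. a w \<in> free_module s" "\<And>w. boundary a w = c' w"
    using assms(2) by (metis boundary_acyclic)
  have "c w - boundary a w \<in> im" for w using a'(2) by (simp add: a(3) c'_def)
  with a show "\<exists>a. chain (j + 1) a \<and> (\<forall>w. a w \<in> free_module s) \<and> (\<forall>w. c w - boundary a w \<in> im)"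
    by blast
qed

text \<open>The connecting map read backwards: the image of \<open>b\<close> has to be the boundary
  of some \<open>c\<close>. For \<open>j \<ge> 2\<close> this is acyclicity; for
  \<open>j = 1\<close> it holds because the entries have no constant term. Now \<open>c\<close> is a
  cycle modulo the image, so it differs from a boundary by a chain in the image, and a lift of that
  chain bounds \<open>b\<close> modulo the kernel.\<close>

lemma koszul_vanishes_ker:
  assumes "koszul_vanishes s im j t" and "j \<ge> 2 \<or> j = 1 \<and> (\<forall>v\<in>im. \<forall>k. v k \<in> var_ideal UNIV)"
  shows "koszul_vanishes s' ker (j - 1) t"
  unfolding koszul_vanishes_def
proof (intro allI impI, elim conjE)
  fix b :: "bool list \<Rightarrow> ('n, 'k) fvec"
  assume b: "chain (j - 1) b" "\<forall>w. b w \<in> graded_part s' (t - wt w)" "\<forall>w. boundary b w \<in> ker"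
  have bim: "\<phi> (b w) \<in> im" for w using b(2) graded_part_free_module by blast
  have "\<exists>c. chain j c \<and> (\<forall>w. boundary c w = \<phi> (b w))"
  proof (cases "j \<ge> 2")
    case True
    have "boundary (\<lambda>w. \<phi> (b w)) w = 0" for w using b(3) by (simp add: koszul_diff)
    from boundary_acyclic[OF chain_image[OF b(1)] _ this free_module] True
    obtain c where "chain (j - 1 + 1) c" "\<And>w. boundary c w = \<phi> (b w)"
      by (metis add_le_imp_le_diff one_add_one)
    thus ?thesis by auto
  next
    case False
    with assms(2) have j: "j = 1" and im: "\<forall>v\<in>im. \<forall>k. v k \<in> var_ideal UNIV" by auto
    define z where "z = replicate (length (var_list :: 'n list)) False"
    have "\<phi> (b z) k \<in> var_ideal (set var_list)" for k using im bim var_list(2) by metis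
    from koszul_chain_top_of_var_ideal[of "\<phi> (b z)", OF this]
    obtain c where c: "chain 1 c" "boundary c z = \<phi> (b z)" unfolding z_def by blast
    have "boundary c w = \<phi> (b w)" for w
    proof (cases "w = z")
      case False
      hence "\<not> (length w = length (var_list :: 'n list) \<and> wt w = 0)"
        unfolding z_def using wt_eq_0_iff[of w] by auto
      hence "b w = 0" "boundary c w = 0"
        using koszul_chainD[OF b(1), of w] koszul_chainD[OF koszul_chain_koszul_diff[OF c(1)], of
            w] j by fastforce+
      thus ?thesis by (simp add: zero)
    qed (simp add: c)
    with c(1) j show ?thesis by blast
  qed
  then obtain c0 where c0: "chain j c0" "\<And>w. boundary c0 w = \<phi> (b w)" by blast
  define c where "c w = graded_proj s (t - wt w) (c0 w)" for w
  have c: "chain j c" "c w \<in> graded_part s (t - wt w)" "boundary c w = \<phi> (b w)" for w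
  proof -
    show "chain j c" unfolding c_def by (rule koszul_chain_graded_proj[OF c0(1)])
    show "c w \<in> graded_part s (t - wt w)" unfolding c_def by (rule graded_proj_graded_part)
    have "boundary c w = graded_proj s (t - wt w) (\<phi> (b w))"
      by (simp add: c_def[abs_def] koszul_diff_graded_proj c0(2))
    also have "\<dots> = \<phi> (b w)" by (rule graded_proj_id, rule graded_part_image) (use b(2) in blast)
    finally show "boundary c w = \<phi> (b w)" .
  qed
  have "boundary c w \<in> im" for w by (simp only: c(3) bim)
  from koszul_vanishesD[OF assms(1) c(1,2) this] obtain a where
    a: "chain (j + 1) a" "\<And>w. a w \<in> free_module s" "\<And>w. c w - boundary a w \<in> im" by blast
  have "chain j (\<lambda>w. c w - boundary a w)" unfolding koszul_chain_def
  proof (intro allI impI)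
    fix w assume "c w - boundary a w \<noteq> 0"
    hence "c w \<noteq> 0 \<or> boundary a w \<noteq> 0" by auto
    thus "length w = length (var_list :: 'n list) \<and> wt w = j"
      using koszul_chainD[OF c(1)] koszul_chainD[OF koszul_chain_koszul_diff[OF a(1)]] by auto
  qed
  from lift[OF this a(3)] obtain b' where
    b': "chain j b'" "\<And>w. b' w \<in> free_module s'" "\<And>w. \<phi> (b' w) = c w - boundary a w" by blast
  have "b w - boundary b' w \<in> ker" for w
  proof -
    have "\<phi> (boundary b' w) = \<phi> (b w)"
      by (simp add: koszul_diff[symmetric] b'(3) koszul_diff_diff koszul_diff_koszul_diff c(3))
    moreover have "b w \<in> free_module s'" using b(2) graded_part_free_module by blast
    moreover have "boundary b' w \<in> free_module s'"
      by (rule koszul_diff_in_subspace[OF free_module_subspace b'(2)])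
    ultimately show ?thesis by (simp add: diff free_module_closed)
  qed
  with b' show "\<exists>a. chain (j - 1 + 1) a \<and> (\<forall>w. a w \<in> free_module s') \<and> (\<forall>w. b w - boundary a w \<in> ker)"
    by auto
qed

end

text \<open>If \<open>H\<^sub>1(F/N)\<close> vanishes in degree \<open>t\<close>, then \<open>N\<close> has no minimal generator of degree \<open>t\<close>.\<close>

lemma koszul_vanishes_one_generators:
  assumes "koszul_vanishes s N 1 t" and "graded_sub s N" and "\<And>v k. v \<in> N \<Longrightarrow> v k \<in> var_ideal UNIV"
    and "v \<in> N" and "v \<in> graded_part s t"
  obtains c z where "\<And>w. c w \<in> N \<inter> graded_part s (t - 1)" "boundary c z = v"
proof -
  have sub: "fvec.subspace N" and N: "N \<subseteq> free_module s" and prN: "\<And>v t. v \<in> N \<Longrightarrow> graded_proj s t v \<in> N"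
    using assms(2) by (auto simp: graded_sub_def)
  define z where "z = replicate (length (var_list :: 'a list)) False"
  have wz: "wt z = 0" by (simp add: z_def)
  have "v k \<in> var_ideal (set var_list)" for k using assms(3,4) var_list(2) by metis
  from koszul_chain_top_of_var_ideal[of v, OF this]
  obtain c0 where c0: "chain 1 c0" "boundary c0 z = v" unfolding z_def by blast
  define c where "c w = graded_proj s (t - wt w) (c0 w)" for w
  have c: "chain 1 c" "c w \<in> graded_part s (t - wt w)" for w
    unfolding c_def by (rule koszul_chain_graded_proj[OF c0(1)], rule graded_proj_graded_part)
  have cz: "boundary c z = v"
    using graded_proj_id[OF assms(5)] by (simp add: c_def[abs_def] koszul_diff_graded_proj c0(2) wz)
  have "boundary c w \<in> N" for w
  proof (cases "w = z")
    case False
    hence "\<not> (length w = length (var_list :: 'a list) \<and> wt w = 0)"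
      unfolding z_def using wt_eq_0_iff[of w] by auto
    hence "boundary c w = 0"
      using koszul_chainD[OF koszul_chain_koszul_diff[OF c(1)], of w] by fastforce
    thus ?thesis using fvec.subspace_0[OF sub] by simp
  qed (simp add: cz assms(4))
  from koszul_vanishesD[OF assms(1) c this] obtain a where
    a: "chain (1 + 1) a" "\<And>w. a w \<in> free_module s" "\<And>w. c w - boundary a w \<in> N" by blast
  \<comment> \<open>Subtracting a boundary moves the coefficients of the variables into
    \<open>N\<close> without changing their combination \<open>v\<close>. Off weight 1 both chains
    vanish, so all values of \<open>c'\<close> have degree \<open>t - 1\<close>.\<close>
  define c' where "c' w = graded_proj s (t - wt w) (c w - boundary a w)" for w
  have c': "c' w \<in> N \<inter> graded_part s (t - 1)" for w
  proof (cases "wt w = 1")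
    case True
    thus ?thesis using prN[OF a(3)] graded_proj_graded_part by (simp add: c'_def)
  next
    case False
    hence "c w = 0" "boundary a w = 0"
      using koszul_chainD[OF c(1), of w] koszul_chainD[OF koszul_chain_koszul_diff[OF a(1)], of w]
          by auto
    thus ?thesis using fvec.subspace_0[OF sub] graded_part_closed(1) by (simp add: c'_def)
  qed
  have "boundary c' z = graded_proj s (t - wt z) (boundary (\<lambda>w. c w - boundary a w) z)"
    unfolding c'_def by (rule koszul_diff_graded_proj)
  also have "\<dots> = v"
    using graded_proj_id[OF assms(5)] by (simp add: koszul_diff_diff koszul_diff_koszul_diff cz wz)
  finally show ?thesis using that c' by blast
qed

section \<open>Koszul homology in the lowest and highest homological degrees\<close>

lemma chain_pointI:
  assumes "length z = length (var_list :: 'n::finite list)" and "wt z = j"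
  shows "chain j (\<lambda>w. if w = z then v else 0 :: ('n, 'k::field) fvec)"
  unfolding koszul_chain_def
proof (intro allI impI)
  fix w assume "(if w = z then v else 0) \<noteq> (0 :: ('n, 'k) fvec)"
  hence "w = z" by meson
  with assms show "length w = length (var_list :: 'n list) \<and> wt w = j" by simp
qed

lemma chain_wt_le:
  assumes "chain j c" and "c w \<noteq> (0 :: ('n::finite, 'k::field) fvec)"
  shows "j \<le> int (card (UNIV :: 'n set))"
  using koszul_chainD[OF assms] count_le_length[of w True] by (simp add: length_var_list)

lemma chain_0_eq_0:
  assumes "chain 0 c" and "w \<noteq> replicate (length (var_list :: 'n list)) False"
  shows "c w = (0 :: ('n::finite, 'k::field) fvec)"
proof (rule ccontr)
  assume "c w \<noteq> 0"
  from koszul_chainD[OF assms(1) this] assms(2) show False by (metis wt_eq_0_iff)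
qed

lemma wt_replicate: "wt (replicate n True) = int n" "wt (replicate n False) = 0"
  by (induction n) auto

text \<open>H_0(F/N) is F/(N + mF), with m the maximal homogeneous ideal. As N lies in mF this is
  F/mF, whose part of degree \<open>t\<close> is spanned by the basis vectors of that
  degree.\<close>

lemma koszul_vanishes_0_iff:
  fixes N :: "('n::finite, 'k::field) fvec set"
  assumes sub: "fvec.subspace N" and m: "\<And>v k. v \<in> N \<Longrightarrow> v k \<in> var_ideal UNIV"
  shows "koszul_vanishes s N 0 t \<longleftrightarrow> t \<notin> set s"
proof
  define z where "z = replicate (length (var_list :: 'n list)) False"
  have z: "length z = length (var_list :: 'n list)" "wt z = 0" by (simp_all add: z_def wt_replicate)
  assume van: "koszul_vanishes s N 0 t"
  show "t \<notin> set s"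
  proof
    assume "t \<in> set s"
    then obtain k where k: "k < length s" "s ! k = t" by (auto simp: in_set_conv_nth)
    define e :: "('n, 'k) fvec" where "e i = (if i = k then 1 else 0)" for i
    have e: "e \<in> graded_part s t"
      using k by (simp add: graded_part_def free_module_def e_def homogeneous_def)
    define c where "c w = (if w = z then e else 0)" for w
    have c: "chain 0 c" unfolding c_def by (rule chain_pointI[OF z])
    have cg: "c w \<in> graded_part s (t - wt w)" for w
      using e z(2) by (simp add: c_def graded_part_closed(1))
    have "boundary c w = 0" for w
      using koszul_chainD[OF koszul_chain_koszul_diff[OF c], of w] by fastforce
    hence "boundary c w \<in> N" for w using fvec.subspace_0[OF sub] by simp
    from koszul_vanishesD[OF van c cg this] obtain a where a: "\<And>w. c w - boundary a w \<in> N" by metis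
    have "(c z - boundary a z) k = 1 - boundary a z k" unfolding minus_apply c_def e_def by simp
    with m[OF a, of z k] have "1 - boundary a z k \<in> var_ideal (UNIV :: 'n set)" by simp
    moreover have "boundary a z k \<in> var_ideal UNIV"
      using koszul_diff_var_ideal[of var_list a z k] by (simp add: var_list(2))
    ultimately have "1 - boundary a z k + boundary a z k \<in> var_ideal (UNIV :: 'n set)"
      by (rule var_ideal_add)
    thus False by (simp add: var_ideal_UNIV)
  qed
next
  define z where "z = replicate (length (var_list :: 'n list)) False"
  have z: "length z = length (var_list :: 'n list)" "wt z = 0" by (simp_all add: z_def wt_replicate)
  assume t: "t \<notin> set s"
  show "koszul_vanishes s N 0 t"
    unfolding koszul_vanishes_def
  proof (intro allI impI, elim conjE)
    fix c :: "bool list \<Rightarrow> ('n, 'k) fvec"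
    assume c: "chain 0 c" "\<forall>w. c w \<in> graded_part s (t - wt w)"
    have cz: "c z \<in> graded_part s t" using spec[OF c(2), of z] z(2) by simp
    have "c z k \<in> var_ideal (set var_list)" for k
    proof (cases "k < length s")
      case True
      hence "homogeneous (t - s ! k) (c z k)" using cz by (simp add: graded_part_def)
      moreover have "t - s ! k \<noteq> 0" using t True nth_mem[OF True] by fastforce
      ultimately have "0 \<notin> Poly_Mapping.keys (c z k)" unfolding homogeneous_def by force
      thus ?thesis by (simp add: var_list(2) var_ideal_UNIV in_keys_iff)
    next
      case False
      thus ?thesis using graded_part_free_module[OF cz] by (simp add: free_module_def)
    qed
    from koszul_chain_top_of_var_ideal[of "c z", OF this]
    obtain a0 where a0: "chain 1 a0" "boundary a0 z = c z" unfolding z_def by blast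
    define a where "a w = graded_proj s (t - wt w) (a0 w)" for w
    have a: "chain 1 a" "a w \<in> free_module s" for w
      unfolding a_def by (rule koszul_chain_graded_proj[OF a0(1)], rule graded_part_free_module[OF
          graded_proj_graded_part])
    have "boundary a z = c z"
      using graded_proj_id[OF cz] by (simp add: a_def[abs_def] koszul_diff_graded_proj a0(2) z(2))
    moreover have "boundary a w = 0" "c w = 0" if "w \<noteq> z" for w
      using chain_0_eq_0[OF c(1)] chain_0_eq_0[of "boundary a" w] koszul_chain_koszul_diff[OF a(1)] that
      unfolding z_def by simp_all
    ultimately have "c w - boundary a w = 0" for w by (cases "w = z") simp_all
    hence "c w - boundary a w \<in> N" for w using fvec.subspace_0[OF sub] by simp
    thus "\<exists>a. chain (0 + 1) a \<and> (\<forall>w. a w \<in> free_module s) \<and> (\<forall>w. c w - boundary a w \<in> N)"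
      using a by (intro exI[of _ a]) simp
  qed
qed

text \<open>The zero primitive suffices when every cycle modulo \<open>N\<close> already has its
  values in \<open>N\<close>; this covers the three cases below in which no boundary has to be
  found.\<close>

lemma koszul_vanishesI_pointwise:
  assumes "\<And>c w. chain j c \<Longrightarrow> (\<And>w. c w \<in> graded_part s (t - wt w)) \<Longrightarrow> (\<And>w. boundary c w \<in> N) \<Longrightarrow> c w \<in> N"
  shows "koszul_vanishes s N j t"
  unfolding koszul_vanishes_def
proof (intro allI impI, elim conjE)
  fix c :: "bool list \<Rightarrow> ('a, 'b) fvec"
  assume c: "chain j c" "\<forall>w. c w \<in> graded_part s (t - wt w)" "\<forall>w. boundary c w \<in> N"
  have "c w \<in> N" for w by (rule assms) (use c in blast)+
  thus "\<exists>a. chain (j + 1) a \<and> (\<forall>w. a w \<in> free_module s) \<and> (\<forall>w. c w - boundary a w \<in> N)"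
    by (intro exI[of _ "\<lambda>_. 0"]) (simp add: koszul_chain_def free_module_closed)
qed

lemma koszul_vanishes_high:
  fixes N :: "('n::finite, 'k::field) fvec set"
  assumes "fvec.subspace N" and "j > int (card (UNIV :: 'n set))"
  shows "koszul_vanishes s N j t"
proof (rule koszul_vanishesI_pointwise)
  fix c :: "bool list \<Rightarrow> ('n, 'k) fvec" and w
  assume "chain j c"
  hence "c w = 0" using chain_wt_le[of j c w] assms(2) by linarith
  thus "c w \<in> N" using fvec.subspace_0[OF assms(1)] by simp
qed

text \<open>The nonzero coefficients of a chain sit on words of weight \<open>j\<close>, so they
  have degree \<open>t - j\<close>, which is at least \<open>T\<close>.\<close>

lemma koszul_vanishes_large_degree:
  assumes "fvec.subspace N" and "\<And>u. u \<ge> T \<Longrightarrow> graded_part s u \<subseteq> N" and "t \<ge> T + j"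
  shows "koszul_vanishes s N j t"
proof (rule koszul_vanishesI_pointwise)
  fix c :: "bool list \<Rightarrow> ('a, 'b) fvec" and w
  assume c: "chain j c" "\<And>w. c w \<in> graded_part s (t - wt w)"
  show "c w \<in> N"
  proof (cases "c w = 0")
    case False
    with koszul_chainD[OF c(1)] have "wt w = j" by blast
    with assms(3) have "t - wt w \<ge> T" by linarith
    with assms(2) c(2) show ?thesis by blast
  qed (simp add: fvec.subspace_0[OF assms(1)])
qed

text \<open>There are no chains above homological degree n, so only the zero primitive is left, and
  \<open>koszul_diff_top\<close> turns cycles into socle elements. The one word of top weight has
  weight n, which is the source of the offset between shifts and socle degrees.\<close>

lemma koszul_vanishes_top_iff:
  fixes N :: "('n::finite, 'k::field) fvec set"
  assumes sub: "fvec.subspace N"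
  shows "koszul_vanishes s N (int (card (UNIV :: 'n set))) t \<longleftrightarrow>
    (\<forall>v\<in>graded_part s (t - int (card (UNIV :: 'n set))). (\<forall>i. smul (Var i) v \<in> N) \<longrightarrow> v \<in> N)"
    (is "_ \<longleftrightarrow> ?soc")
proof
  define z where "z = replicate (length (var_list :: 'n list)) True"
  have z: "length z = length (var_list :: 'n list)" "wt z = int (card (UNIV :: 'n set))"
    by (simp_all add: z_def wt_replicate length_var_list)
  assume van: "koszul_vanishes s N (int (card (UNIV :: 'n set))) t"
  show ?soc
  proof (intro ballI impI)
    fix v assume v: "v \<in> graded_part s (t - int (card (UNIV :: 'n set)))" "\<forall>i. smul (Var i) v \<in> N"
    define c where "c w = (if w = z then v else 0)" for w
    have c: "chain (int (card (UNIV :: 'n set))) c" unfolding c_def by (rule chain_pointI[OF z])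
    have cg: "c w \<in> graded_part s (t - wt w)" for w
      using v(1) z(2) by (simp add: c_def graded_part_closed(1))
    have "c z = v" by (simp add: c_def)
    hence "\<forall>w. boundary c w \<in> N"
      using koszul_diff_top[OF sub c[folded length_var_list]] v(2) by (simp add: z_def)
    with koszul_vanishesD[OF van c cg] obtain a where
      a: "chain (int (card (UNIV :: 'n set)) + 1) a" "\<And>w. c w - boundary a w \<in> N" by metis
    have "a w = 0" for w using chain_wt_le[OF a(1), of w] by linarith
    hence "a = (\<lambda>_. 0)" by (rule ext)
    with a(2)[of z] \<open>c z = v\<close> show "v \<in> N" by simp
  qed
next
  define z where "z = replicate (length (var_list :: 'n list)) True"
  assume soc: ?soc
  show "koszul_vanishes s N (int (card (UNIV :: 'n set))) t"
  proof (rule koszul_vanishesI_pointwise)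
    fix c :: "bool list \<Rightarrow> ('n, 'k) fvec" and w
    assume c: "chain (int (card (UNIV :: 'n set))) c" "\<And>w. c w \<in> graded_part s (t - wt w)"
      and "\<And>w. boundary c w \<in> N"
    hence *: "\<forall>i. smul (Var i) (c z) \<in> N"
      using koszul_diff_top[OF sub c(1)[folded length_var_list]] by (simp add: var_list(2) z_def)
    have wz: "wt z = int (card (UNIV :: 'n set))" by (simp add: z_def wt_replicate length_var_list)
    have "c z \<in> N" using soc c(2)[of z] * wz by simp
    moreover have "c w = 0" if "w \<noteq> z"
    proof (rule ccontr)
      assume "c w \<noteq> 0"
      from koszul_chainD[OF c(1) this] that show False
        unfolding z_def by (metis wt_eq_length_iff length_var_list)
    qed
    ultimately show "c w \<in> N"
      by (cases "w = z") (simp_all add: fvec.subspace_0[OF sub])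
  qed
qed

section \<open>Shifts of a minimal resolution\<close>

text \<open>Here \<open>\<phi> i\<close> runs from the module \<open>i + 1\<close> to the module
  \<open>i\<close>, one index below the matrices of a resolution. The augmentation is left out: the
  resolved module is the cokernel of \<open>\<phi> 0\<close>.\<close>

locale minimal_complex =
  fixes d :: "nat \<Rightarrow> int list" and \<phi> :: "nat \<Rightarrow> ('n::finite, 'k::field) fvec \<Rightarrow> ('n, 'k) fvec"
  assumes hom: "graded_hom (d (Suc i)) (d i) (\<phi> i)"
    and exact: "{v \<in> free_module (d (Suc i)). \<phi> i v = 0} = \<phi> (Suc i) ` free_module (d (Suc (Suc i)))"
    and minimal: "v \<in> \<phi> i ` free_module (d (Suc i)) \<Longrightarrow> v k \<in> var_ideal UNIV"
begin

text \<open>Each step along the resolution trades one homological degree at the same internal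
  degree. The offset \<open>j\<close> stays general because the step for \<open>j\<close> uses the
  hypothesis at \<open>Suc j\<close>.\<close>

lemma koszul_vanishes_shift:
  "koszul_vanishes (d 0) (\<phi> 0 ` free_module (d (Suc 0))) (int (j + i)) t \<longleftrightarrow>
    koszul_vanishes (d i) (\<phi> i ` free_module (d (Suc i))) (int j) t"
proof (induction i arbitrary: j)
  case (Suc i)
  interpret graded_hom "d (Suc i)" "d i" "\<phi> i" by (rule hom)
  have "koszul_vanishes (d i) im (int (Suc j)) t \<longleftrightarrow> koszul_vanishes (d (Suc i)) ker (int (Suc j) - 1) t"
  proof
    assume "koszul_vanishes (d i) im (int (Suc j)) t"
    thus "koszul_vanishes (d (Suc i)) ker (int (Suc j) - 1) t"
      using minimal by (intro koszul_vanishes_ker) auto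
  next
    assume "koszul_vanishes (d (Suc i)) ker (int (Suc j) - 1) t"
    thus "koszul_vanishes (d i) im (int (Suc j)) t" by (intro koszul_vanishes_im) auto
  qed
  with Suc.IH[of "Suc j"] show ?case by (simp add: exact)
qed simp

text \<open>This is the description of graded Betti numbers by Tor, reduced to the question whether
  they vanish and with Tor computed by the Koszul complex.\<close>

lemma shift_iff: "t \<in> set (d i) \<longleftrightarrow> \<not> koszul_vanishes (d 0) (\<phi> 0 ` free_module (d (Suc 0))) (int i) t"
proof -
  interpret graded_hom "d (Suc i)" "d i" "\<phi> i" by (rule hom)
  have "fvec.subspace im" using graded_sub_im by (simp add: graded_sub_def)
  moreover have "v k \<in> var_ideal UNIV" if "v \<in> im" for v k using minimal that by blast
  ultimately have "koszul_vanishes (d i) im 0 t \<longleftrightarrow> t \<notin> set (d i)" by (rule koszul_vanishes_0_iff)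
  with koszul_vanishes_shift[of 0 i t] show ?thesis by simp
qed

lemma length_resolution:
  assumes "i > card (UNIV :: 'n set)"
  shows "d i = []"
proof -
  interpret graded_hom "d (Suc 0)" "d 0" "\<phi> 0" by (rule hom)
  have "fvec.subspace im" using graded_sub_im by (simp add: graded_sub_def)
  from koszul_vanishes_high[OF this] assms have "t \<notin> set (d i)" for t by (simp add: shift_iff)
  thus ?thesis by (metis list.set_intros(1) neq_Nil_conv)
qed

lemma last_shift_iff:
  "t \<in> set (d (card (UNIV :: 'n set))) \<longleftrightarrow>
    (\<exists>v\<in>graded_part (d 0) (t - int (card (UNIV :: 'n set))).
      (\<forall>i. smul (Var i) v \<in> \<phi> 0 ` free_module (d (Suc 0))) \<and> v \<notin> \<phi> 0 ` free_module (d (Suc 0)))"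
proof -
  interpret graded_hom "d (Suc 0)" "d 0" "\<phi> 0" by (rule hom)
  have "fvec.subspace im" using graded_sub_im by (simp add: graded_sub_def)
  from koszul_vanishes_top_iff[OF this, of "d 0" t] show ?thesis unfolding shift_iff by blast
qed

end

section \<open>Existence of minimal generators\<close>

text \<open>Scalars act as constant polynomials, which makes bases and dimension over the field
  available for single graded pieces.\<close>

interpretation kvec: vector_space "\<lambda>(c :: 'k::field) (v :: ('n, 'k) fvec). smul
    (Poly_Mapping.single 0 c) v"
  by unfold_locales
    (simp_all add: fvec.scale_right_distrib fvec.scale_left_distrib single_add mult_single)

lemma finite_mono_deg_le: "finite {m :: 'n::finite \<Rightarrow>\<^sub>0 nat. mono_deg m \<le> M}"
proof (rule finite_imageD)
  have "Poly_Mapping.lookup m i \<le> mono_deg m" for m :: "'n \<Rightarrow>\<^sub>0 nat" and i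
    unfolding mono_deg_def by (intro member_le_sum) simp_all
  from order_trans[OF this]
  have "Poly_Mapping.lookup ` {m :: 'n \<Rightarrow>\<^sub>0 nat. mono_deg m \<le> M} \<subseteq> PiE UNIV (\<lambda>_. {..M})"
    by (simp add: PiE_UNIV_domain image_subset_iff)
  thus "finite (Poly_Mapping.lookup ` {m :: 'n \<Rightarrow>\<^sub>0 nat. mono_deg m \<le> M})"
    by (rule finite_subset) (simp add: finite_PiE)
  show "inj_on Poly_Mapping.lookup {m :: 'n \<Rightarrow>\<^sub>0 nat. mono_deg m \<le> M}"
    by (rule inj_onI) (simp only: poly_mapping_eq_iff)
qed

lemma sum_keys_single: "(\<Sum>m\<in>Poly_Mapping.keys p. Poly_Mapping.single m (Poly_Mapping.lookup p m)) = p"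
  by (rule poly_mapping_eqI)
    (simp add: lookup_sum lookup_single when_def sum.delta in_keys_iff)

definition unit_fvec :: "nat \<Rightarrow> ('n, 'k::field) mpoly \<Rightarrow> ('n, 'k) fvec"
  where "unit_fvec k f = (\<lambda>i. if i = k then f else 0)"

lemma graded_part_finite_dim:
  "\<exists>B. finite B \<and> graded_part s t \<subseteq> kvec.span (B :: ('n::finite, 'k::field) fvec set)"
proof -
  \<comment> \<open>All monomials up to the required degree are taken, which is enough for a finite
    spanning set. A negative degree is turned into 0 by \<open>nat\<close>, harmlessly, since no
    monomial of \<open>v\<close> occurs there.\<close>
  define B :: "('n, 'k) fvec set"
    where "B = (\<Union>k<length s. (\<lambda>m. unit_fvec k (Poly_Mapping.single m 1)) ` {m. mono_deg m \<le> nat (t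
        - s ! k)})"
  have "v \<in> kvec.span B" if v: "v \<in> graded_part s t" for v
  proof -
    have *: "smul (Poly_Mapping.single 0 (Poly_Mapping.lookup (v k) m)) (unit_fvec k
        (Poly_Mapping.single m 1)) i
        = (if i = k then Poly_Mapping.single m (Poly_Mapping.lookup (v k) m) else 0)" for k m i
      by (simp add: unit_fvec_def fvec_apply mult_single)
    have "(\<Sum>k<length s. \<Sum>m\<in>Poly_Mapping.keys (v k).
        smul (Poly_Mapping.single 0 (Poly_Mapping.lookup (v k) m)) (unit_fvec k
            (Poly_Mapping.single m 1))) i
        = v i" for i
    proof -
      have "v i = (if i < length s then v i else 0)"
        using graded_part_free_module[OF v] by (simp add: free_module_def)
      also have "\<dots> = (\<Sum>k<length s. if i = k then v k else 0)" by (simp add: sum.delta)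
      also have "\<dots> = (\<Sum>k<length s. \<Sum>m\<in>Poly_Mapping.keys (v k).
          if i = k then Poly_Mapping.single m (Poly_Mapping.lookup (v k) m) else 0)"
        by (intro sum.cong refl) (simp add: sum_keys_single)
      finally show ?thesis by (simp add: sum_fun_apply *)
    qed
    hence "v = (\<Sum>k<length s. \<Sum>m\<in>Poly_Mapping.keys (v k).
        smul (Poly_Mapping.single 0 (Poly_Mapping.lookup (v k) m)) (unit_fvec k
            (Poly_Mapping.single m 1)))"
      by (intro ext) (rule sym)
    also have "\<dots> \<in> kvec.span B"
    proof (intro kvec.span_sum kvec.span_scale kvec.span_base)
      fix k m assume k: "k \<in> {..<length s}" and m: "m \<in> Poly_Mapping.keys (v k)"
      hence "int (mono_deg m) = t - s ! k" using v by (auto simp: graded_part_def homogeneous_def)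
      thus "unit_fvec k (Poly_Mapping.single m 1) \<in> B" using k unfolding B_def by force
    qed
    finally show ?thesis .
  qed
  moreover have "finite B" unfolding B_def by (simp add: finite_mono_deg_le)
  ultimately show ?thesis by blast
qed

lemma kvec_subspace: "fvec.subspace N \<Longrightarrow> kvec.subspace N"
  unfolding kvec.subspace_def fvec.subspace_def by blast

lemma graded_part_basis:
  fixes N :: "('n::finite, 'k::field) fvec set"
  assumes "fvec.subspace N"
  shows "\<exists>B. finite B \<and> B \<subseteq> N \<inter> graded_part s t \<and> N \<inter> graded_part s t \<subseteq> kvec.span B"
proof -
  obtain C :: "('n, 'k) fvec set" where C: "finite C" "graded_part s t \<subseteq> kvec.span C"
    using graded_part_finite_dim by metis
  obtain B where B: "B \<subseteq> N \<inter> graded_part s t" "kvec.independent B" "N \<inter> graded_part s t \<subseteq> kvec.span B"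
    using kvec.basis_exists[of "N \<inter> graded_part s t"] by metis
  have "B \<subseteq> kvec.span C" using B(1) C(2) by blast
  with kvec.independent_span_bound[OF C(1) B(2)] have "finite B" by simp
  with B show ?thesis by blast
qed

lemma graded_part_eq_0:
  assumes "v \<in> graded_part s t" and "\<And>x. x \<in> set s \<Longrightarrow> t < x"
  shows "v = 0"
proof (rule ext)
  fix k
  show "v k = 0 k"
  proof (cases "k < length s")
    case True
    hence "homogeneous (t - s ! k) (v k)" and "t - s ! k < 0"
      using assms by (simp_all add: graded_part_def)
    hence "Poly_Mapping.keys (v k) = {}" unfolding homogeneous_def by fastforce
    thus ?thesis by (simp add: fvec_apply)
  next
    case False
    thus ?thesis using graded_part_free_module[OF assms(1)] by (simp add: free_module_def fvec_apply)
  qed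
qed

text \<open>No chain condition on ideals enters: bases of the finitely many graded pieces between
  the lowest degree of the free module and \<open>T\<close> suffice, because above \<open>T\<close>
  every element comes from the piece one degree below.\<close>

lemma finite_generators:
  fixes N :: "('n::finite, 'k::field) fvec set"
  assumes N: "graded_sub s N"
    and gen: "\<And>t v. t > T \<Longrightarrow> v \<in> N \<Longrightarrow> v \<in> graded_part s t \<Longrightarrow>
      \<exists>c z. (\<forall>w :: bool list. c w \<in> N \<inter> graded_part s (t - 1)) \<and> boundary c z = v"
  shows "\<exists>G. finite G \<and> (\<forall>g\<in>G. \<exists>t. g \<in> graded_part s t) \<and> fvec.span G = N"
proof -
  have sub: "fvec.subspace N" and Nf: "N \<subseteq> free_module s" and prN: "\<And>v t. v \<in> N \<Longrightarrow> graded_proj s t v \<in> N"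
    using N by (auto simp: graded_sub_def)
  obtain B where B: "\<And>t. finite (B t)" "\<And>t. B t \<subseteq> N \<inter> graded_part s t" "\<And>t. N \<inter> graded_part s t \<subseteq>
      kvec.span (B t)"
    using graded_part_basis[OF sub] by metis
  obtain t0 where t0: "\<And>x. x \<in> set s \<Longrightarrow> t0 \<le> x"
    using bdd_below_finite[of "set s"] unfolding bdd_below_def by auto
  define G where "G = (\<Union>t\<in>{t0..T}. B t)"
  \<comment> \<open>Degrees are integers, so the induction runs over a bound \<open>i\<close> for
    their distance from \<open>t0\<close>; below \<open>t0\<close> the graded pieces are
    zero.\<close>
  have step: "N \<inter> graded_part s t \<subseteq> fvec.span G" if "t < t0 + int i" for t i
    using that
  proof (induction i arbitrary: t)
    case 0
    show ?case
    proof
      fix v assume "v \<in> N \<inter> graded_part s t"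
      hence "v = 0" using graded_part_eq_0[of v s t] t0 0 by fastforce
      thus "v \<in> fvec.span G" by (simp add: fvec.span_zero)
    qed
  next
    case (Suc i)
    show ?case
    proof
      fix v assume v: "v \<in> N \<inter> graded_part s t"
      consider "t < t0" | "t0 \<le> t" "t \<le> T" | "t > T" by linarith
      thus "v \<in> fvec.span G"
      proof cases
        case 1
        hence "v = 0" using graded_part_eq_0[of v s t] t0 v by fastforce
        thus ?thesis by (simp add: fvec.span_zero)
      next
        case 2
        hence "B t \<subseteq> fvec.span G" unfolding G_def by (intro order_trans[OF _ fvec.span_superset]) force
        hence "kvec.span (B t) \<subseteq> fvec.span G"
          by (rule kvec.span_minimal) (rule kvec_subspace[OF fvec.subspace_span])
        with B(3) v show ?thesis by blast
      next
        case 3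
        obtain c :: "bool list \<Rightarrow> ('n, 'k) fvec" and z
            where c: "\<And>w. c w \<in> N \<inter> graded_part s (t - 1)" "boundary c z = v"
          using gen[OF 3, of v] v by (metis IntD1 IntD2)
        have "N \<inter> graded_part s (t - 1) \<subseteq> fvec.span G" by (rule Suc.IH) (use Suc.prems in simp)
        hence "c w \<in> fvec.span G" for w using c(1) by (rule subsetD)
        hence "boundary c z \<in> fvec.span G" by (rule koszul_diff_in_subspace[OF fvec.subspace_span])
        with c(2) show ?thesis by simp
      qed
    qed
  qed
  have "finite G" unfolding G_def using B(1) by simp
  moreover have GN: "G \<subseteq> N" "\<forall>g\<in>G. \<exists>t. g \<in> graded_part s t" unfolding G_def using B(2) by blast+
  moreover have "fvec.span G = N"
  proof (rule fvec.span_subspace[OF GN(1) _ sub], rule subsetI)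
    fix v assume v: "v \<in> N"
    with Nf obtain D where D: "finite D" "v = (\<Sum>t\<in>D. graded_proj s t v)"
      using sum_graded_proj by (metis subsetD)
    have "graded_proj s t v \<in> fvec.span G" for t
    proof -
      have "t < t0 + int (nat (t - t0 + 1))" by linarith
      from step[OF this] show ?thesis using prN[OF v] graded_proj_graded_part by (meson IntI subsetD)
    qed
    hence "(\<Sum>t\<in>D. graded_proj s t v) \<in> fvec.span G" by (intro fvec.span_sum)
    with D(2) show "v \<in> fvec.span G" by simp
  qed
  ultimately show ?thesis by metis
qed

section \<open>Graded homomorphisms given by lists of homogeneous vectors\<close>

definition lin_comb :: "('n, 'k::field) fvec list \<Rightarrow> ('n, 'k) fvec \<Rightarrow> ('n, 'k) fvec"
  where "lin_comb L v = (\<Sum>j<length L. smul (v j) (L ! j))"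

lemma lin_comb_apply: "lin_comb L v k = (\<Sum>j<length L. v j * (L ! j) k)"
  by (simp add: lin_comb_def sum_fun_apply smul_apply)

lemma lin_comb_unit_fvec: "j < length L \<Longrightarrow> lin_comb L (unit_fvec j f) = smul f (L ! j)"
  by (rule ext) (simp add: lin_comb_apply unit_fvec_def smul_apply if_distrib[of "\<lambda>x. x * _"]
      sum.delta cong: if_cong)

lemma graded_hom_lin_comb:
  assumes "length ds = length L" and L: "\<And>j. j < length L \<Longrightarrow> L ! j \<in> graded_part s (ds ! j)"
  shows "graded_hom ds s (lin_comb L)"
proof
  show "lin_comb L (u + v) = lin_comb L u + lin_comb L v" for u v
    by (simp add: lin_comb_def fvec_apply fvec.scale_left_distrib sum.distrib)
  show "lin_comb L (smul f u) = smul f (lin_comb L u)" for f u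
    by (simp add: lin_comb_def fvec_apply fvec.scale_sum_right)
  show "lin_comb L v \<in> free_module s" for v
    unfolding lin_comb_def
    by (intro fvec.subspace_sum[OF free_module_subspace] free_module_closed
        graded_part_free_module[OF L]) simp
  show "lin_comb L (graded_proj ds t v) = graded_proj s t (lin_comb L v)" for t v
  proof (rule ext)
    fix k
    show "lin_comb L (graded_proj ds t v) k = graded_proj s t (lin_comb L v) k"
    proof (cases "k < length s")
      case True
      have "hom_comp (t - s ! k) (v j * (L ! j) k)
          = graded_proj ds t v j * (L ! j) k" if "j < length L" for j
      proof -
        have "homogeneous (ds ! j - s ! k) ((L ! j) k)"
          using L[OF that] True by (simp add: graded_part_def)
        from hom_comp_mult[OF this, of "t - s ! k" "v j"] show ?thesis
          using that assms(1) by (simp add: graded_proj_apply mult.commute)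
      qed
      thus ?thesis using True by (simp add: graded_proj_apply lin_comb_apply hom_comp_sum)
    next
      case False
      have "(L ! j) k = 0" if "j < length L" for j
        using graded_part_free_module[OF L[OF that]] False by (simp add: free_module_def)
      thus ?thesis using False by (simp add: graded_proj_apply lin_comb_apply)
    qed
  qed
qed

lemma lin_comb_image:
  assumes "length ds = length L"
  shows "lin_comb L ` free_module ds = fvec.span (set L)"
proof (intro equalityI subsetI)
  fix x assume "x \<in> lin_comb L ` free_module ds"
  then obtain v where "x = lin_comb L v" by blast
  also have "\<dots> \<in> fvec.span (set L)"
    unfolding lin_comb_def by (intro fvec.span_sum fvec.span_scale fvec.span_base) simp
  finally show "x \<in> fvec.span (set L)" .
next
  fix x assume "x \<in> fvec.span (set L)"
  thus "x \<in> lin_comb L ` free_module ds"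
  proof (induction rule: fvec.span_induct_alt)
    case base
    have "lin_comb L 0 = 0" by (rule ext) (simp add: lin_comb_apply fvec_apply)
    thus ?case using free_module_closed(1) by (metis image_eqI)
  next
    case (step c x y)
    then obtain v j where v: "v \<in> free_module ds" "y = lin_comb L v" and j: "j < length L" "x = L ! j"
      by (auto simp: in_set_conv_nth)
    have "lin_comb L (unit_fvec j c + v) = smul c x + y"
      unfolding v(2) j(2) lin_comb_unit_fvec[OF j(1), symmetric]
      by (simp add: lin_comb_def fvec_apply fvec.scale_left_distrib sum.distrib)
    moreover have "unit_fvec j c + v \<in> free_module ds"
      using v(1) j(1) assms by (intro free_module_closed(2))
          (simp_all add: free_module_def unit_fvec_def)
    ultimately show ?case by (metis image_eqI)
  qed
qed

text \<open>
  A relation with a coefficient outside the maximal ideal would have, in the right degree, a unit as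
  coefficient and make one generator redundant.
\<close>

lemma lin_comb_kernel_minimal:
  assumes len: "length ds = length L" and L: "\<And>j. j < length L \<Longrightarrow> L ! j \<in> graded_part s (ds ! j)"
    and dist: "distinct L"
    and min: "\<And>G. finite G \<Longrightarrow> (\<forall>g\<in>G. \<exists>t. g \<in> graded_part s t) \<Longrightarrow> fvec.span G = fvec.span (set L) \<Longrightarrow>
      card (set L) \<le> card G"
    and v: "v \<in> free_module ds" "lin_comb L v = 0"
  shows "v j \<in> var_ideal UNIV"
proof (cases "j < length L")
  case False
  thus ?thesis using v(1) len by (simp add: free_module_def)
next
  case True
  interpret graded_hom ds s "lin_comb L" using len L by (rule graded_hom_lin_comb)
  \<comment> \<open>In this degree coordinate \<open>j\<close> is reduced to the constant term of
    \<open>v j\<close>, and \<open>u\<close> is still a relation.\<close>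
  define u where "u = graded_proj ds (ds ! j) v"
  have lu: "lin_comb L u = 0" using v graded_proj[OF v(1)] by (simp add: u_def)
  have uj: "u j = Poly_Mapping.single 0 (Poly_Mapping.lookup (v j) 0)"
    using homogeneous_0_const[OF homogeneous_hom_comp[of 0 "v j"]] True len
    by (simp add: u_def graded_proj_apply lookup_hom_comp)
  show ?thesis
  proof (rule ccontr)
    assume "v j \<notin> var_ideal UNIV"
    define a where "a = Poly_Mapping.lookup (v j) 0"
    have a: "a \<noteq> 0" using \<open>v j \<notin> var_ideal UNIV\<close> by (simp add: var_ideal_UNIV a_def)
    define G where "G = set L - {L ! j}"
    have "lin_comb L u = smul (u j) (L ! j) + (\<Sum>i\<in>{..<length L} - {j}. smul (u i) (L ! i))"
      unfolding lin_comb_def using True by (subst sum.remove[of _ j]) simp_all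
    from eq_neg_iff_add_eq_0[THEN iffD2, OF trans[OF sym[OF this] lu]]
    have Lj: "smul (u j) (L ! j) = - (\<Sum>i\<in>{..<length L} - {j}. smul (u i) (L ! i))" .
    have "(\<Sum>i\<in>{..<length L} - {j}. smul (u i) (L ! i)) \<in> fvec.span G"
    proof (intro fvec.span_sum fvec.span_scale fvec.span_base)
      fix i assume "i \<in> {..<length L} - {j}"
      hence i: "i < length L" "i \<noteq> j" by simp_all
      hence "L ! i \<noteq> L ! j" using nth_eq_iff_index_eq[OF dist i(1) True] by metis
      thus "L ! i \<in> G" using i(1) unfolding G_def by (metis DiffI nth_mem singletonD)
    qed
    from fvec.span_neg[OF this]
    have "smul (u j) (L ! j) \<in> fvec.span G" unfolding Lj .
    hence *: "smul (Poly_Mapping.single 0 (inverse a)) (smul (u j) (L ! j)) \<in> fvec.span G"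
      by (rule fvec.span_scale)
    have "Poly_Mapping.single 0 (inverse a) * u j = 1"
      using a unfolding uj a_def[symmetric] mult_single by simp
    with * have Lj_span: "L ! j \<in> fvec.span G" unfolding fvec.scale_scale by simp
    have "x \<in> fvec.span G" if "x \<in> set L" for x
    proof (cases "x = L ! j")
      case True
      thus ?thesis by (simp only: Lj_span)
    next
      case False
      hence "x \<in> G" using that unfolding G_def by blast
      thus ?thesis by (rule fvec.span_base)
    qed
    hence "set L \<subseteq> fvec.span G" by (rule subsetI)
    moreover have "G \<subseteq> fvec.span (set L)"
      unfolding G_def using fvec.span_superset[of "set L"] by blast
    ultimately have "fvec.span G = fvec.span (set L)" by (simp only: fvec.span_eq)
    moreover have "\<forall>g\<in>G. \<exists>t. g \<in> graded_part s t"
    proof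
      fix g assume "g \<in> G"
      then obtain i where "i < length L" "g = L ! i" by (auto simp: G_def in_set_conv_nth)
      thus "\<exists>t. g \<in> graded_part s t" using L by metis
    qed
    ultimately have "card (set L) \<le> card G" by (intro min) (simp_all add: G_def)
    moreover have "card G < card (set L)"
      unfolding G_def using True by (intro card_Diff1_less) simp_all
    ultimately show False by simp
  qed
qed

text \<open>The invariant of the step by step construction of a resolution: \<open>N\<close> is the module to be
covered next.\<close>

definition syzygy_state :: "int list \<Rightarrow> ('n::finite, 'k::field) fvec set \<Rightarrow> bool"
  where "syzygy_state s N \<longleftrightarrow> graded_sub s N \<and> (\<forall>v\<in>N. \<forall>k. v k \<in> var_ideal UNIV) \<and>
    (\<forall>j\<ge>1. \<exists>T. \<forall>t>T. koszul_vanishes s N j t)"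

text \<open>Minimality of the generators is recorded by the next \<open>syzygy_state\<close>: it
  says that all relations among them have coefficients in the maximal ideal.\<close>

definition minimal_cover ::
    "int list \<Rightarrow> ('n::finite, 'k::field) fvec set \<Rightarrow> int list \<Rightarrow> ('n, 'k) fvec list \<Rightarrow> bool"
  where "minimal_cover s N ds L \<longleftrightarrow> length ds = length L \<and>
    (\<forall>j<length L. L ! j \<in> graded_part s (ds ! j)) \<and> lin_comb L ` free_module ds = N"

text \<open>Vanishing of H_1 in large degrees gives a finite homogeneous generating set, and one of
  least cardinality has its relations in the maximal ideal. Vanishing of H_j for the kernel comes
  from that of H_(j+1) for \<open>N\<close>, which is why the invariant speaks of all
  \<open>j \<ge> 1\<close>.\<close>

lemma syzygy_step:
  fixes N :: "('n::finite, 'k::field) fvec set"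
  assumes "syzygy_state s N"
  shows "\<exists>ds L. minimal_cover s N ds L \<and> syzygy_state ds {v \<in> free_module ds. lin_comb L v = 0}"
proof -
  have N: "graded_sub s N" and m: "\<And>v k. v \<in> N \<Longrightarrow> v k \<in> var_ideal UNIV"
    and van: "\<And>j. j \<ge> 1 \<Longrightarrow> \<exists>T. \<forall>t>T. koszul_vanishes s N j t"
    using assms unfolding syzygy_state_def by simp_all
  define P where "P G \<longleftrightarrow> finite G \<and> (\<forall>g\<in>G. \<exists>t. g \<in> graded_part s t) \<and> fvec.span G = N" for G
  obtain T where T: "\<And>t. t > T \<Longrightarrow> koszul_vanishes s N 1 t" using van[of 1] by auto
  have "\<exists>G. P G"
    unfolding P_def
  proof (rule finite_generators[OF N])
    fix t and v :: "('n, 'k) fvec" assume tv: "t > T" "v \<in> N" "v \<in> graded_part s t"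
    show "\<exists>c z. (\<forall>w. c w \<in> N \<inter> graded_part s (t - 1)) \<and> boundary c z = v"
      using koszul_vanishes_one_generators[OF T[OF tv(1)] N _ tv(2,3)] m by metis
  qed
  then obtain G where G: "P G" "\<And>G'. P G' \<Longrightarrow> card G \<le> card G'"
    using ex_has_least_nat[of P _ card] by metis
  obtain L where L: "set L = G" "distinct L" using G(1) finite_distinct_list unfolding P_def by metis
  obtain deg where deg: "\<And>g. g \<in> G \<Longrightarrow> g \<in> graded_part s (deg g)" using G(1) unfolding P_def by metis
  define ds where "ds = map deg L"
  have len: "length ds = length L" by (simp add: ds_def)
  have hL: "L ! j \<in> graded_part s (ds ! j)" if "j < length L" for j
    using that deg L(1) by (auto simp: ds_def)
  have img: "lin_comb L ` free_module ds = N"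
    using lin_comb_image[OF len] G(1) L(1) by (simp add: P_def)
  interpret graded_hom ds s "lin_comb L" using len hL by (rule graded_hom_lin_comb)
  have "v k \<in> var_ideal UNIV" if "v \<in> ker" for v k
    using len hL L(2)
  proof (rule lin_comb_kernel_minimal)
    fix G' assume "finite G'" "\<forall>g\<in>G'. \<exists>t. g \<in> graded_part s t" "fvec.span G' = fvec.span (set L)"
    hence "P G'" using G(1) L(1) by (simp add: P_def)
    thus "card (set L) \<le> card G'" using G(2) L(1) by simp
  qed (use that in auto)
  moreover have "\<exists>T. \<forall>t>T. koszul_vanishes ds ker j t" if "j \<ge> 1" for j
  proof -
    have "j + 1 \<ge> 1" using that by simp
    from van[OF this] obtain T where "\<And>t. t > T \<Longrightarrow> koszul_vanishes s N (j + 1) t" by metis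
    hence "koszul_vanishes ds ker (j + 1 - 1) t" if "t > T" for t
      using that \<open>j \<ge> 1\<close> by (intro koszul_vanishes_ker) (simp_all add: img)
    thus ?thesis by auto
  qed
  ultimately have "syzygy_state ds ker" using graded_sub_ker by (simp add: syzygy_state_def)
  moreover have "minimal_cover s N ds L" using len hL img by (simp add: minimal_cover_def)
  ultimately show ?thesis by blast
qed

lemma syzygy_sequence:
  fixes N :: "('n::finite, 'k::field) fvec set"
  assumes "syzygy_state s N"
  shows "\<exists>d L. d 0 = s \<and> minimal_cover (d 0) N (d 1) (L 0) \<and>
    (\<forall>i. minimal_cover (d (Suc i)) {v \<in> free_module (d (Suc i)). lin_comb (L i) v
        = 0} (d (Suc (Suc i))) (L (Suc i))) \<and>
    (\<forall>i. syzygy_state (d (Suc i)) {v \<in> free_module (d (Suc i)). lin_comb (L i) v = 0})"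
proof -
  \<comment> \<open>A state holds the shifts and the generators of the last cover; the module to be
    covered next is its kernel. The initial \<open>N\<close> is no such kernel, so its cover is made
    separately.\<close>
  define St where "St x \<longleftrightarrow> syzygy_state (fst x) {v \<in> free_module (fst x). lin_comb (snd x) v = 0}"
    for x :: "int list \<times> ('n, 'k) fvec list"
  define R where "R x y \<longleftrightarrow> minimal_cover (fst x) {v \<in> free_module (fst x). lin_comb (snd x) v
      = 0} (fst y) (snd y)"
    for x y :: "int list \<times> ('n, 'k) fvec list"
  obtain ds0 L0 where 0: "minimal_cover s N ds0 L0
      \<and> syzygy_state ds0 {v \<in> free_module ds0. lin_comb L0 v = 0}"
    using syzygy_step[OF assms] by (elim exE) (rule that)
  define x0 where "x0 = (ds0, L0)"
  have x0: "minimal_cover s N (fst x0) (snd x0)" "St x0"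
    using 0 unfolding St_def x0_def fst_conv snd_conv by (rule conjunct1, rule conjunct2)
  have next_ex: "\<exists>y. St y \<and> R x y" if St_x: "St x" for x
  proof -
    obtain ds L where "minimal_cover (fst x) {v \<in> free_module (fst x). lin_comb (snd x) v = 0} ds L \<and>
        syzygy_state ds {v \<in> free_module ds. lin_comb L v = 0}"
      using syzygy_step[OF St_x[unfolded St_def]] by (elim exE) (rule that)
    hence "R x (ds, L)" "St (ds, L)"
      unfolding R_def St_def fst_conv snd_conv by (rule conjunct1, rule conjunct2)
    thus ?thesis by (intro exI conjI)
  qed
  define nxt where "nxt x = (SOME y. St y \<and> R x y)" for x
  have nxt: "St (nxt x)" "R x (nxt x)" if "St x" for x
    using someI_ex[OF next_ex[OF that]] by (simp_all add: nxt_def)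
  define f where "f n = (nxt ^^ n) x0" for n
  have St: "St (f n)" for n by (induction n) (simp_all add: f_def x0(2) nxt(1))
  have R: "R (f n) (f (Suc n))" for n using nxt(2)[OF St[of n]] by (simp add: f_def)
  define d where "d n = (case n of 0 \<Rightarrow> s | Suc n \<Rightarrow> fst (f n))" for n
  have d: "d 0 = s" "d (Suc n) = fst (f n)" for n by (simp_all add: d_def)
  show ?thesis
  proof (intro exI conjI allI)
    show "d 0 = s" by (rule d)
    show "minimal_cover (d 0) N (d 1) (snd (f 0))" using x0(1) by (simp add: d f_def)
    show "minimal_cover (d (Suc i)) {v \<in> free_module (d (Suc i)). lin_comb (snd (f i)) v = 0}
        (d (Suc (Suc i))) (snd (f (Suc i)))" for i
      using R[of i] unfolding R_def d .
    show "syzygy_state (d (Suc i)) {v \<in> free_module (d (Suc i)). lin_comb (snd (f i)) v = 0}" for i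
      using St[of i] unfolding St_def d .
  qed
qed

section \<open>Level algebras and the socle\<close>

definition fvec_of_vec :: "('n, 'k::field) mpoly vec \<Rightarrow> ('n, 'k) fvec"
  where "fvec_of_vec v = (\<lambda>k. if k < dim_vec v then v $ k else 0)"

lemma fvec_of_vec_free_module: "v \<in> carrier_vec (length s) \<Longrightarrow> fvec_of_vec v \<in> free_module s"
  by (auto simp: fvec_of_vec_def free_module_def)

lemma fvec_of_vec_vec: "f \<in> free_module s \<Longrightarrow> fvec_of_vec (vec (length s) f) = f"
  by (auto simp: fvec_of_vec_def free_module_def fun_eq_iff)

lemma fvec_of_vec_image_carrier: "fvec_of_vec ` carrier_vec (length s) = free_module s"
proof (intro equalityI subsetI)
  fix f :: "('a, 'b) fvec" assume "f \<in> free_module s"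
  hence "f = fvec_of_vec (vec (length s) f)" by (simp add: fvec_of_vec_vec)
  thus "f \<in> fvec_of_vec ` carrier_vec (length s)" by (metis imageI vec_carrier)
qed (auto simp: fvec_of_vec_free_module)

lemma fvec_of_vec_eq_0_iff: "v \<in> carrier_vec r \<Longrightarrow> fvec_of_vec v = 0 \<longleftrightarrow> v = 0\<^sub>v r"
  by (auto simp: fvec_of_vec_def fun_eq_iff fvec_apply vec_eq_iff)

definition fvec_cols :: "('n, 'k::field) mpoly mat \<Rightarrow> ('n, 'k) fvec list"
  where "fvec_cols A = map (\<lambda>j. fvec_of_vec (col A j)) [0..<dim_col A]"

lemma length_fvec_cols [simp]: "length (fvec_cols A) = dim_col A"
  by (simp add: fvec_cols_def)

lemma nth_fvec_cols: "j < dim_col A \<Longrightarrow> (fvec_cols A ! j) k = (if k < dim_row A then A $$ (k, j) else 0)"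
  by (simp add: fvec_cols_def fvec_of_vec_def)

lemma lin_comb_fvec_cols:
  assumes "v \<in> carrier_vec (dim_col A)"
  shows "lin_comb (fvec_cols A) (fvec_of_vec v) = fvec_of_vec (A *\<^sub>v v)"
proof (rule ext)
  fix k
  show "lin_comb (fvec_cols A) (fvec_of_vec v) k = fvec_of_vec (A *\<^sub>v v) k"
    using assms by (auto simp: lin_comb_apply nth_fvec_cols fvec_of_vec_def scalar_prod_def
        lessThan_atLeast0 mult.commute
        intro!: sum.cong)
qed

lemma lin_comb_image_fvec_cols:
  assumes "A \<in> carrier_mat (length t) (length s)"
  shows "lin_comb (fvec_cols A) ` free_module s = fvec_of_vec ` mat_image A"
proof -
  have "dim_col A = length s" using assms by simp
  hence "lin_comb (fvec_cols A) ` free_module s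
      = lin_comb (fvec_cols A) ` fvec_of_vec ` carrier_vec (dim_col A)"
    by (simp add: fvec_of_vec_image_carrier)
  also have "\<dots> = (\<lambda>v. fvec_of_vec (A *\<^sub>v v)) ` carrier_vec (dim_col A)"
    unfolding image_image by (intro image_cong refl lin_comb_fvec_cols)
  finally show ?thesis by (simp add: mat_image_def image_image)
qed

lemma lin_comb_kernel_fvec_cols:
  assumes "A \<in> carrier_mat (length t) (length s)"
  shows "{v \<in> free_module s. lin_comb (fvec_cols A) v = 0} = fvec_of_vec ` mat_kernel A"
proof -
  have dim: "dim_col A = length s" "dim_row A = length t" using assms by auto
  have *: "lin_comb (fvec_cols A) (fvec_of_vec v) = 0 \<longleftrightarrow> A *\<^sub>v v = 0\<^sub>v (dim_row A)"
    if "v \<in> carrier_vec (dim_col A)" for v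
    unfolding lin_comb_fvec_cols[OF that] by (rule fvec_of_vec_eq_0_iff) (rule carrier_vecI, simp)
  have "{v \<in> free_module s. lin_comb (fvec_cols A) v = 0}
      = {v \<in> fvec_of_vec ` carrier_vec (dim_col A). lin_comb (fvec_cols A) v = 0}"
    by (simp add: fvec_of_vec_image_carrier dim)
  also have "\<dots> = fvec_of_vec ` {v \<in> carrier_vec (dim_col A). A *\<^sub>v v = 0\<^sub>v (dim_row A)}"
    using * by (force simp: image_iff)
  finally show ?thesis by (simp add: mat_kernel_def)
qed

lemma fvec_of_vec_inj: "inj_on fvec_of_vec (carrier_vec r)"
proof (rule inj_onI)
  fix u v :: "('a, 'b) mpoly vec"
  assume uv: "u \<in> carrier_vec r" "v \<in> carrier_vec r" "fvec_of_vec u = fvec_of_vec v"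
  show "u = v"
  proof (rule eq_vecI)
    fix i assume "i < dim_vec v"
    thus "u $ i = v $ i" using fun_cong[OF uv(3), of i] uv(1,2) by (simp add: fvec_of_vec_def)
  qed (use uv in auto)
qed

lemma maximal_homogeneous_ideal_eq:
  "maximal_homogeneous_ideal = (var_ideal UNIV :: ('n::finite, 'k::field) mpoly set)"
proof
  show "maximal_homogeneous_ideal \<subseteq> (var_ideal UNIV :: ('n, 'k) mpoly set)"
    unfolding maximal_homogeneous_ideal_def
    by (intro ideals.span_minimal var_ideal_subspace) (auto intro: var_ideal_Var)
  have "var_ideal X \<subseteq> (ideals.span (Var ` X) :: ('n, 'k) mpoly set)" if "finite X" for X
    using that
  proof (induction X)
    case empty
    show ?case by (auto simp: var_ideal_def)
  next
    case (insert x X)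
    show ?case
    proof
      fix f :: "('n, 'k) mpoly" assume "f \<in> var_ideal (insert x X)"
      then obtain q where "f - Var x * q \<in> var_ideal X" using var_ideal_insert_decomp by metis
      hence "f - Var x * q \<in> ideals.span (Var ` insert x X)"
        using insert.IH ideals.span_mono[of "Var ` X" "Var ` insert x X"] by blast
      moreover have "q * Var x \<in> ideals.span (Var ` insert x X)"
        by (intro ideals.span_scale ideals.span_base) simp
      ultimately have "(f - Var x * q) + q * Var x \<in> ideals.span (Var ` insert x X)"
        by (rule ideals.span_add)
      thus "f \<in> ideals.span (Var ` insert x X)" by (simp add: mult.commute)
    qed
  qed
  from this[of UNIV] show "var_ideal UNIV \<subseteq> (maximal_homogeneous_ideal :: ('n, 'k) mpoly set)"
    by (simp add: maximal_homogeneous_ideal_def)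
qed

lemma homogeneous_ideal_subspace: "homogeneous_ideal I \<Longrightarrow> ideals.subspace I"
  by (auto simp: homogeneous_ideal_def)

lemma homogeneous_ideal_hom_comp:
  assumes "homogeneous_ideal I" and "f \<in> I"
  shows "hom_comp t f \<in> I"
proof -
  obtain G where G: "\<And>g. g \<in> G \<Longrightarrow> \<exists>t. homogeneous t g" "I = ideals.span G"
    using assms(1) unfolding homogeneous_ideal_def by metis
  from assms(2)[unfolded G(2)] have "hom_comp t f \<in> ideals.span G"
  proof (induction rule: ideals.span_induct_alt)
    case base
    thus ?case by (simp add: ideals.span_zero)
  next
    case (step c x y)
    obtain s where "homogeneous s x" using G(1)[OF step(1)] by metis
    from hom_comp_mult[OF this, of t c] have "hom_comp t (c * x) = hom_comp (t - s) c * x"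
      by (simp add: mult.commute)
    with step show ?case
      by (simp add: hom_comp_add ideals.span_add ideals.span_scale ideals.span_base)
  qed
  thus ?thesis by (simp add: G(2))
qed

definition socle_degree :: "('n::finite, 'k::field) mpoly set \<Rightarrow> int \<Rightarrow> bool"
  where "socle_degree I u \<longleftrightarrow> (\<exists>f. homogeneous u f \<and> f \<notin> I \<and> (\<forall>i. Var i * f \<in> I))"

lemma minimal_complex_of_resolution:
  fixes \<phi> :: "nat \<Rightarrow> ('n::finite, 'k::field) mpoly mat"
  assumes "minimal_graded_free_resolution I d \<phi> g"
  shows "minimal_complex d (\<lambda>i. lin_comb (fvec_cols (\<phi> (Suc i))))"
proof -
  have res: "graded_map (d (Suc i)) (d i) (\<phi> (Suc i))"
      "mat_kernel (\<phi> (Suc i)) = mat_image (\<phi> (Suc (Suc i)))"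
      "elements_mat (\<phi> (Suc i)) \<subseteq> maximal_homogeneous_ideal" for i
    using assms unfolding minimal_graded_free_resolution_def graded_free_resolution_def by simp_all
  have car: "\<phi> (Suc i) \<in> carrier_mat (length (d i)) (length (d (Suc i)))" for i
    using res(1) by (simp add: graded_map_def)
  have dim: "dim_col (\<phi> (Suc i)) = length (d (Suc i))" "dim_row (\<phi> (Suc i)) = length (d i)" for i
    using car[of i] by auto
  show ?thesis
  proof (rule minimal_complex.intro)
    fix i
    show "graded_hom (d (Suc i)) (d i) (lin_comb (fvec_cols (\<phi> (Suc i))))"
    proof (rule graded_hom_lin_comb)
      show "length (d (Suc i)) = length (fvec_cols (\<phi> (Suc i)))" by (simp add: dim)
      fix j assume "j < length (fvec_cols (\<phi> (Suc i)))"
      thus "fvec_cols (\<phi> (Suc i)) ! j \<in> graded_part (d i) (d (Suc i) ! j)"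
        using res(1)[of i] by
            (simp add: graded_part_def free_module_def nth_fvec_cols dim graded_map_def)
    qed
    show "{v \<in> free_module (d (Suc i)). lin_comb (fvec_cols (\<phi> (Suc i))) v = 0} =
        lin_comb (fvec_cols (\<phi> (Suc (Suc i)))) ` free_module (d (Suc (Suc i)))"
      unfolding lin_comb_kernel_fvec_cols[OF car[of i]] lin_comb_image_fvec_cols[OF car[of "Suc
          i"]] res(2) ..
    fix v k assume "v \<in> lin_comb (fvec_cols (\<phi> (Suc i))) ` free_module (d (Suc i))"
    then obtain u where u: "v = lin_comb (fvec_cols (\<phi> (Suc i))) u" by (elim imageE)
    have entry: "(fvec_cols (\<phi> (Suc i)) ! j) k \<in> var_ideal UNIV" if "j < length (d (Suc i))" for j
    proof (cases "k < length (d i)")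
      case True
      have "\<phi> (Suc i) $$ (k, j) \<in> elements_mat (\<phi> (Suc i))"
        using car[of i] True that by (rule elements_matI) simp
      thus ?thesis using res(3)[of i] True that
        by (auto simp: nth_fvec_cols dim maximal_homogeneous_ideal_eq)
    qed (simp add: nth_fvec_cols dim that)
    show "v k \<in> var_ideal UNIV"
      unfolding u lin_comb_apply
      by (intro ideals.subspace_sum[OF var_ideal_subspace] var_ideal_mult entry) (simp add: dim)
  qed
qed

text \<open>The augmentation induces an isomorphism from the quotient of the first free module by
  \<open>N\<close> onto S/I, whatever the rank of that module. It respects multiplication and
  homogeneous components, so it carries one socle onto the other.\<close>

lemma last_shift_iff_socle_degree:
  fixes I :: "('n::finite, 'k::field) mpoly set"
  assumes res: "minimal_graded_free_resolution I d \<phi> g" and hI: "homogeneous_ideal I"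
  shows "t \<in> set (d (card (UNIV :: 'n set))) \<longleftrightarrow> socle_degree I (t - int (card (UNIV :: 'n set)))"
proof -
  interpret minimal_complex d "\<lambda>i. lin_comb (fvec_cols (\<phi> (Suc i)))"
    using res by (rule minimal_complex_of_resolution)
  define u where "u = t - int (card (UNIV :: 'n set))"
  have res: "graded_map (d 1) (d 0) (\<phi> 1)" "g \<in> carrier_vec (length (d 0))"
      "\<And>j. j < length (d 0) \<Longrightarrow> homogeneous (d 0 ! j) (g $ j)"
      "\<And>f. \<exists>v\<in>carrier_vec (length (d 0)). f - g \<bullet> v \<in> I"
      "{v \<in> carrier_vec (length (d 0)). g \<bullet> v \<in> I} = mat_image (\<phi> 1)"
    using res unfolding minimal_graded_free_resolution_def graded_free_resolution_def by simp_all
  define aug where "aug v = (\<Sum>k<length (d 0). g $ k * v k)" for v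
  have aug: "g \<bullet> v = aug (fvec_of_vec v)" if "v \<in> carrier_vec (length (d 0))" for v
    using that by (auto simp: aug_def fvec_of_vec_def scalar_prod_def lessThan_atLeast0 intro!:
        sum.cong)
  define N where "N = lin_comb (fvec_cols (\<phi> (Suc 0))) ` free_module (d (Suc 0))"
  have N: "v \<in> N \<longleftrightarrow> aug v \<in> I" if v: "v \<in> free_module (d 0)" for v
  proof -
    define w where "w = vec (length (d 0)) v"
    have w: "w \<in> carrier_vec (length (d 0))" "fvec_of_vec w = v"
      using v by (simp_all add: w_def fvec_of_vec_vec)
    have "N = fvec_of_vec ` mat_image (\<phi> 1)"
      unfolding N_def using lin_comb_image_fvec_cols[of "\<phi> 1" "d 0" "d 1"] res(1) by
          (simp add: graded_map_def)
    hence "v \<in> N \<longleftrightarrow> fvec_of_vec w \<in> fvec_of_vec ` {v \<in> carrier_vec (length (d 0)). g \<bullet> v \<in> I}"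
      by (simp only: res(5) w(2))
    also have "\<dots> \<longleftrightarrow> w \<in> {v \<in> carrier_vec (length (d 0)). g \<bullet> v \<in> I}"
      by (rule inj_on_image_mem_iff[OF fvec_of_vec_inj w(1)]) blast
    also have "\<dots> \<longleftrightarrow> aug v \<in> I" using w aug[OF w(1)] by simp
    finally show ?thesis .
  qed
  have aug_sm: "aug (smul f v) = f * aug v" for f v
    unfolding aug_def smul_apply sum_distrib_left by (intro sum.cong refl mult.left_commute)
  have aug_graded_proj: "aug (graded_proj (d 0) u v) = hom_comp u (aug v)" for v
    unfolding aug_def hom_comp_sum
    by (intro sum.cong refl) (simp add: graded_proj_apply hom_comp_mult[OF res(3)])
  have sub: "ideals.subspace I" using hI by (rule homogeneous_ideal_subspace)
  have "(\<exists>v\<in>graded_part (d 0) u. (\<forall>i. smul (Var i) v \<in> N) \<and> v \<notin> N) \<longleftrightarrow> socle_degree I u"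
  proof
    assume "\<exists>v\<in>graded_part (d 0) u. (\<forall>i. smul (Var i) v \<in> N) \<and> v \<notin> N"
    then obtain v where v: "v \<in> graded_part (d 0) u" "\<forall>i. smul (Var i) v \<in> N" "v \<notin> N"
      by (elim bexE conjE) (rule that)
    have vf: "v \<in> free_module (d 0)" using v(1) by (rule graded_part_free_module)
    have "hom_comp u (aug v) = aug v"
      using aug_graded_proj[of v] unfolding graded_proj_id[OF v(1)] by (rule sym)
    hence "homogeneous u (aug v)" by (simp only: hom_comp_id_iff)
    moreover have "aug v \<notin> I" using v(3) N[OF vf] by simp
    moreover have "Var i * aug v \<in> I" for i
      using spec[OF v(2), of i] N[OF free_module_closed(4)[OF vf]] by (simp add: aug_sm)
    ultimately show "socle_degree I u"
      unfolding socle_degree_def by (intro exI[of _ "aug v"] conjI allI)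
  next
    assume "socle_degree I u"
    then obtain f where f: "homogeneous u f" "f \<notin> I" "\<And>i. Var i * f \<in> I"
      unfolding socle_degree_def by metis
    obtain v0 where v0: "v0 \<in> carrier_vec (length (d 0))" "f - g \<bullet> v0 \<in> I" using res(4) by metis
    \<comment> \<open>The preimage is projected to degree \<open>u\<close>; as \<open>I\<close> is
      homogeneous, it still represents \<open>f\<close> modulo \<open>I\<close>.\<close>
    define v where "v = graded_proj (d 0) u (fvec_of_vec v0)"
    have "hom_comp u (f - g \<bullet> v0) \<in> I" using homogeneous_ideal_hom_comp[OF hI v0(2)] .
    hence fvec_of_vec: "f - aug v \<in> I"
      using f(1) hom_comp_id_iff[of u f] by
          (simp add: hom_comp_diff aug[OF v0(1)] aug_graded_proj v_def)
    have v: "v \<in> graded_part (d 0) u" unfolding v_def by (rule graded_proj_graded_part)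
    hence vf: "v \<in> free_module (d 0)" by (rule graded_part_free_module)
    have "aug v \<notin> I"
    proof
      assume "aug v \<in> I"
      from ideals.subspace_add[OF sub fvec_of_vec this] f(2) show False by simp
    qed
    hence "v \<notin> N" using N[OF vf] by simp
    moreover have "smul (Var i) v \<in> N" for i
    proof -
      have "Var i * f - Var i * (f - aug v) \<in> I"
        by (intro ideals.subspace_diff[OF sub] f(3) ideals.subspace_scale[OF sub] fvec_of_vec)
      hence "aug (smul (Var i) v) \<in> I" by (simp add: aug_sm algebra_simps)
      thus ?thesis using N[OF free_module_closed(4)[OF vf]] by simp
    qed
    ultimately show "\<exists>v\<in>graded_part (d 0) u. (\<forall>i. smul (Var i) v \<in> N) \<and> v \<notin> N"
      using v by (intro bexI[of _ v] conjI allI)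
  qed
  thus ?thesis using last_shift_iff[of t] by (simp add: N_def u_def)
qed

lemma resolution_length:
  fixes I :: "('n::finite, 'k::field) mpoly set"
  assumes "minimal_graded_free_resolution I d \<phi> g" and "i > card (UNIV :: 'n set)"
  shows "d i = []"
proof -
  interpret minimal_complex d "\<lambda>i. lin_comb (fvec_cols (\<phi> (Suc i)))"
    using assms(1) by (rule minimal_complex_of_resolution)
  show ?thesis using assms(2) by (rule length_resolution)
qed

text \<open>The construction starts with S itself and \<open>N\<close> equal to \<open>I\<close> in
  coordinate 0. Properness puts \<open>I\<close> into the maximal ideal, and \<open>bounded\<close>
  gives the vanishing of Koszul homology in large degrees that the invariant demands.\<close>

lemma minimal_resolution_exists:
  fixes I :: "('n::finite, 'k::field) mpoly set"
  assumes hom: "homogeneous_ideal I" and proper: "1 \<notin> I"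
    and bounded: "\<And>u f. u \<ge> T \<Longrightarrow> homogeneous u f \<Longrightarrow> f \<in> I"
  shows "\<exists>d \<phi> g. minimal_graded_free_resolution I d \<phi> g"
proof -
  have sub: "ideals.subspace I" using hom by (rule homogeneous_ideal_subspace)
  define N where "N = {v \<in> free_module [0]. v 0 \<in> I}"
  have subN: "fvec.subspace N"
    unfolding N_def using ideals.subspace_0[OF sub] ideals.subspace_add[OF sub]
        ideals.subspace_scale[OF sub]
    by (intro fvec.subspaceI) (simp_all add: free_module_closed fvec_apply)
  have Im: "f \<in> var_ideal UNIV" if "f \<in> I" for f
  proof (rule ccontr)
    assume "f \<notin> var_ideal UNIV"
    hence c: "Poly_Mapping.lookup f 0 \<noteq> 0" by (simp add: var_ideal_UNIV)
    \<comment> \<open>The constant term is the component of degree 0 and stays in the homogeneous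
      ideal; being nonzero, it is a unit.\<close>
    have "Poly_Mapping.single 0 (Poly_Mapping.lookup f 0) \<in> I"
      using homogeneous_ideal_hom_comp[OF hom that, of 0]
        homogeneous_0_const[OF homogeneous_hom_comp[of 0 f]] by (simp add: lookup_hom_comp)
    from ideals.subspace_scale[OF sub this, of "Poly_Mapping.single 0 (inverse
        (Poly_Mapping.lookup f 0))"]
    show False using c proper by (simp add: mult_single)
  qed
  have "syzygy_state [0] N"
    unfolding syzygy_state_def graded_sub_def
  proof (intro conjI ballI allI impI)
    show "fvec.subspace N" by (rule subN)
    show "N \<subseteq> free_module [0]" by (auto simp: N_def)
    show "graded_proj [0] t v \<in> N" if "v \<in> N" for v t
      using that graded_part_free_module[OF graded_proj_graded_part[of "[0]" t v]]
          homogeneous_ideal_hom_comp[OF hom]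
      by (simp add: N_def graded_proj_apply)
    show "v k \<in> var_ideal UNIV" if "v \<in> N" for v k
    proof (cases k)
      case 0
      thus ?thesis using that Im by (simp add: N_def)
    next
      case (Suc k')
      thus ?thesis using that by (simp add: N_def free_module_def)
    qed
    have "graded_part [0] u \<subseteq> N" if "u \<ge> T" for u
      using bounded[OF that] by (auto simp: graded_part_def N_def)
    from koszul_vanishes_large_degree[OF subN this] show "\<exists>T. \<forall>t>T. koszul_vanishes [0] N j t" for j
      by (intro exI[of _ "T + j"]) simp
  qed
  from syzygy_sequence[OF this] obtain d L where dL: "d 0 = [0] \<and> minimal_cover (d 0) N (d 1) (L 0) \<and>
    (\<forall>i. minimal_cover (d (Suc i)) {v \<in> free_module (d (Suc i)). lin_comb (L i) v
        = 0} (d (Suc (Suc i))) (L (Suc i))) \<and>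
    (\<forall>i. syzygy_state (d (Suc i)) {v \<in> free_module (d (Suc i)). lin_comb (L i) v = 0})"
    by (elim exE) (rule that)
  define \<phi> where "\<phi> i = mat (length (d (i - 1))) (length (d i)) (\<lambda>(k, j). (L (i - 1) ! j) k)" for i
  define g :: "('n, 'k) mpoly vec" where "g = vec 1 (\<lambda>_. 1)"
  \<comment> \<open>\<open>M i\<close> is the submodule of the \<open>i\<close>-th free module that
    the next one has to cover: \<open>N\<close> at the start, a kernel later.\<close>
  define M where "M i = (case i of 0 \<Rightarrow> N | Suc i' \<Rightarrow> {v \<in> free_module (d (Suc i')). lin_comb (L i')
      v = 0})" for i
  have cover: "minimal_cover (d i) (M i) (d (Suc i)) (L i)" for i
  proof (cases i)
    case 0
    have "minimal_cover (d 0) N (d 1) (L 0)" using dL by (elim conjE)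
    thus ?thesis by (simp add: M_def 0)
  next
    case (Suc i')
    thus ?thesis using dL unfolding M_def by simp
  qed
  have Mm: "v k \<in> var_ideal UNIV" if "v \<in> M i" for v k i
    using that dL \<open>syzygy_state [0] N\<close> unfolding syzygy_state_def
    by (cases i) (simp_all add: M_def)
  have len: "length (L i) = length (d (Suc i))"
    and L: "j < length (d (Suc i)) \<Longrightarrow> L i ! j \<in> graded_part (d i) (d (Suc i) ! j)"
    and img: "lin_comb (L i) ` free_module (d (Suc i)) = M i" for i j
    using cover[of i] by (simp_all add: minimal_cover_def)
  have car: "\<phi> (Suc i) \<in> carrier_mat (length (d i)) (length (d (Suc i)))" for i
    by (simp add: \<phi>_def)
  have cols: "fvec_cols (\<phi> (Suc i)) = L i" for i
  proof (rule nth_equalityI)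
    show "length (fvec_cols (\<phi> (Suc i))) = length (L i)" by (simp add: \<phi>_def len)
    fix j assume "j < length (fvec_cols (\<phi> (Suc i)))"
    hence j: "j < length (d (Suc i))" by (simp add: \<phi>_def)
    show "fvec_cols (\<phi> (Suc i)) ! j = L i ! j"
    proof (rule ext)
      fix k
      show "(fvec_cols (\<phi> (Suc i)) ! j) k = (L i ! j) k"
        using j graded_part_free_module[OF L[OF j]] by (simp add: nth_fvec_cols \<phi>_def free_module_def)
    qed
  qed
  have image: "fvec_of_vec ` mat_image (\<phi> (Suc i)) = M i" for i
    using lin_comb_image_fvec_cols[OF car[of i]] by (simp add: cols img)
  have kernel: "fvec_of_vec ` mat_kernel (\<phi> (Suc i)) = M (Suc i)" for i
    using lin_comb_kernel_fvec_cols[OF car[of i]] by (simp add: cols M_def)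
  have image_carrier: "mat_image (\<phi> (Suc i)) \<subseteq> carrier_vec (length (d i))" for i
    using car[of i] by (auto simp: mat_image_def)
  have "minimal_graded_free_resolution I d \<phi> g"
    unfolding minimal_graded_free_resolution_def graded_free_resolution_def
  proof (intro conjI allI impI)
    show "graded_map (d (Suc i)) (d i) (\<phi> (Suc i))" for i
      unfolding graded_map_def
    proof (intro conjI allI impI)
      show "\<phi> (Suc i) \<in> carrier_mat (length (d i)) (length (d (Suc i)))" by (rule car)
      fix k j assume kj: "k < length (d i)" "j < length (d (Suc i))"
      thus "homogeneous (d (Suc i) ! j - d i ! k) (\<phi> (Suc i) $$ (k, j))"
        using L[OF kj(2)] by (simp add: \<phi>_def graded_part_def)
    qed
    show "g \<in> carrier_vec (length (d 0))" using dL by (simp add: g_def)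
    show "homogeneous (d 0 ! j) (g $ j)" if "j < length (d 0)" for j
      using that dL by (simp add: g_def homogeneous_def)
    show "\<exists>v\<in>carrier_vec (length (d 0)). f - g \<bullet> v \<in> I" for f
      using dL ideals.subspace_0[OF sub]
      by (intro bexI[of _ "vec 1 (\<lambda>_. f)"]) (simp_all add: g_def scalar_prod_def)
    have "fvec_of_vec ` {v \<in> carrier_vec (length (d 0)). g \<bullet> v \<in> I} = N"
    proof -
      have *: "g \<bullet> v = fvec_of_vec v 0" if "v \<in> carrier_vec (length (d 0))" for v
        using that dL by (simp add: g_def scalar_prod_def fvec_of_vec_def)
      have "fvec_of_vec ` {v \<in> carrier_vec (length (d 0)). g \<bullet> v \<in> I}
          = {f \<in> fvec_of_vec ` carrier_vec (length (d 0)). f 0 \<in> I}"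
        using * by (force simp: image_iff)
      thus ?thesis unfolding fvec_of_vec_image_carrier using dL by (simp add: N_def)
    qed
    also have "N = fvec_of_vec ` mat_image (\<phi> 1)" using image[of 0] by (simp add: M_def)
    finally show "{v \<in> carrier_vec (length (d 0)). g \<bullet> v \<in> I} = mat_image (\<phi> 1)"
      using inj_on_image_eq_iff[OF fvec_of_vec_inj] image_carrier[of 0] by
          (metis (no_types, lifting) One_nat_def mem_Collect_eq subsetI)
    show "mat_kernel (\<phi> (Suc i)) = mat_image (\<phi> (Suc (Suc i)))" for i
    proof -
      have "mat_kernel (\<phi> (Suc i)) \<subseteq> carrier_vec (length (d (Suc i)))"
        using car[of i] by (auto simp: mat_kernel_def)
      moreover have "fvec_of_vec ` mat_kernel (\<phi> (Suc i)) = fvec_of_vec ` mat_image (\<phi> (Suc (Suc i)))"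
        by (simp only: kernel image)
      ultimately show ?thesis
        using inj_on_image_eq_iff[OF fvec_of_vec_inj] image_carrier[of "Suc i"] by metis
    qed
    show "elements_mat (\<phi> (Suc i)) \<subseteq> maximal_homogeneous_ideal" for i
    proof
      fix x assume "x \<in> elements_mat (\<phi> (Suc i))"
      then obtain k j where kj: "k < length (d i)" "j < length (d (Suc i))" "x = (L i ! j) k"
        using car[of i] by (auto simp: elements_mat_def \<phi>_def)
      \<comment> \<open>A column is the image of a basis vector, so it lies in \<open>M i\<close>
        and inherits from the invariant that its entries are in the maximal ideal.\<close>
      have "L i ! j = lin_comb (L i) (unit_fvec j 1)" using kj(2) by (simp add: lin_comb_unit_fvec len)
      moreover have "unit_fvec j 1 \<in> free_module (d (Suc i))"
        using kj(2) by (simp add: unit_fvec_def free_module_def)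
      ultimately have "L i ! j \<in> M i" using img by (metis imageI)
      thus "x \<in> maximal_homogeneous_ideal" unfolding maximal_homogeneous_ideal_eq kj(3) by (rule Mm)
    qed
  qed
  thus ?thesis by (intro exI)
qed

text \<open>A nonzero socle makes the \<open>n\<close>-th module nonzero, and nothing follows it, so
  it is the last one. The description of its shifts holds for every minimal resolution: one
  direction applies it to the given resolution, the other to the constructed one.\<close>

theorem level_iff_socle_degree_unique:
  fixes I :: "('n::finite, 'k::field) mpoly set"
  assumes hom: "homogeneous_ideal I" and art: "artinian_quotient I" and proper: "1 \<notin> I"
    and bounded: "\<And>u f. u \<ge> T \<Longrightarrow> homogeneous u f \<Longrightarrow> f \<in> I"
    and socle: "socle_degree I u\<^sub>0"
  shows "level_algebra I \<longleftrightarrow> (\<forall>u. socle_degree I u \<longrightarrow> u = u\<^sub>0)"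
proof
  define n where "n = card (UNIV :: 'n set)"
  assume "level_algebra I"
  then obtain d \<phi> g p where res: "minimal_graded_free_resolution I d \<phi> g"
    and p: "last_free_module d p" "card (set (d p)) = 1"
    unfolding level_algebra_def by (elim conjE exE) (rule that)
  have last: "u + int n \<in> set (d n) \<longleftrightarrow> socle_degree I u" for u
    using last_shift_iff_socle_degree[OF res hom, of "u + int n"] by (simp add: n_def)
  have "d n \<noteq> []" using last[of u\<^sub>0] socle by auto
  moreover have "d i = []" if "i > n" for i
    using resolution_length[OF res] that by (simp add: n_def)
  ultimately have "p = n" using p(1) unfolding last_free_module_def by (metis linorder_neqE_nat)
  with p(2) obtain t where "set (d n) = {t}" by (auto simp: card_1_singleton_iff)
  thus "\<forall>u. socle_degree I u \<longrightarrow> u = u\<^sub>0" using last socle by (metis add_right_cancel singletonD)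
next
  define n where "n = card (UNIV :: 'n set)"
  assume uniq: "\<forall>u. socle_degree I u \<longrightarrow> u = u\<^sub>0"
  obtain d \<phi> g where res: "minimal_graded_free_resolution I d \<phi> g"
  proof -
    have "\<exists>d \<phi> g. minimal_graded_free_resolution I d \<phi> g"
      by (rule minimal_resolution_exists[OF hom proper bounded])
    thus ?thesis using that by (elim exE)
  qed
  have last: "t \<in> set (d n) \<longleftrightarrow> socle_degree I (t - int n)" for t
    using last_shift_iff_socle_degree[OF res hom, of t] by (simp add: n_def)
  have set: "set (d n) = {u\<^sub>0 + int n}"
  proof (intro equalityI subsetI)
    fix t assume "t \<in> set (d n)"
    hence "t - int n = u\<^sub>0" using last uniq by blast
    thus "t \<in> {u\<^sub>0 + int n}" by simp
  next
    fix t assume "t \<in> {u\<^sub>0 + int n}"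
    thus "t \<in> set (d n)" using last[of t] socle by simp
  qed
  have "last_free_module d n"
    unfolding last_free_module_def
  proof (intro conjI allI impI)
    show "d n \<noteq> []" using set by auto
    show "d i = []" if "i > n" for i using resolution_length[OF res] that by (simp add: n_def)
  qed
  moreover have "card (set (d n)) = 1" by (simp add: set)
  ultimately show "level_algebra I"
    unfolding level_algebra_def using hom art res by (intro conjI exI[of _ d] exI[of _ \<phi>] exI[of _
        g] exI[of _ n])
qed

section \<open>Monomial ideals\<close>

interpretation mpoly: vector_space "\<lambda>(c :: 'k::field) (f :: ('n, 'k) mpoly). Poly_Mapping.single 0
    c * f"
  by unfold_locales (simp_all add: distrib_left distrib_right single_add mult_single
      mult.assoc[symmetric])

lemma mpoly_subspace: "ideals.subspace J \<Longrightarrow> mpoly.subspace J"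
  unfolding mpoly.subspace_def ideals.subspace_def by blast

text \<open>A basis of \<open>U\<close> extends to one of \<open>V\<close>, which is finite because
  of \<open>W\<close>; equal cardinalities make the two bases coincide.\<close>

lemma (in vector_space) subspace_eq_of_dim_eq:
  assumes "subspace U" and "U \<subseteq> V" and "V \<subseteq> span W" and "finite W" and "dim U = dim V"
  shows "U = V"
proof -
  obtain B where B: "B \<subseteq> U" "independent B" "U \<subseteq> span B" "card B = dim U"
    using basis_exists[of U] by metis
  obtain C where C: "B \<subseteq> C" "C \<subseteq> V" "independent C" "V \<subseteq> span C"
    using maximal_independent_subset_extend[of B V] B(1,2) assms(2) by (metis order_trans)
  have "finite C"
    using independent_span_bound[OF assms(4) C(3)] C(2) assms(3) by (meson order_trans)
  moreover have "card C = card B"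
    using basis_card_eq_dim[OF C(2,4,3)] B(4) assms(5) by simp
  ultimately have "B = C" using C(1) by (metis card_subset_eq)
  thus ?thesis using C(4) B(1) assms(1,2) span_minimal by blast
qed

definition expo :: "('n::finite \<Rightarrow> nat) \<Rightarrow> 'n \<Rightarrow>\<^sub>0 nat"
  where "expo a = (\<Sum>i\<in>UNIV. Poly_Mapping.single i (a i))"

lemma lookup_expo [simp]: "Poly_Mapping.lookup (expo a) i = a i"
  by (simp add: expo_def lookup_sum lookup_single when_def sum.delta)

lemma mono_deg_expo: "mono_deg (expo a) = sum a UNIV"
  by (simp add: mono_deg_def)

lemma Var_power: "Var i ^ k = Poly_Mapping.single (Poly_Mapping.single i k) (1 :: 'k::field)"
  by (induction k) (simp_all add: Var_def mult_single single_add[symmetric])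

lemma prod_Var_power:
  "(\<Prod>i\<in>UNIV. Var i ^ a i) = Poly_Mapping.single (expo a) (1 :: 'k::field)"
proof -
  have "(\<Prod>i\<in>X. Var i ^ a i) = Poly_Mapping.single (\<Sum>i\<in>X. Poly_Mapping.single i (a i)) (1 :: 'k)"
    for X :: "'a set"
    by (induction X rule: infinite_finite_induct) (simp_all add: Var_power mult_single)
  thus ?thesis by (simp add: expo_def)
qed

lemma mono_divides_iff:
  fixes g m :: "'n::finite \<Rightarrow>\<^sub>0 nat"
  shows "(\<exists>h. m = h + g) \<longleftrightarrow> (\<forall>i. Poly_Mapping.lookup g i \<le> Poly_Mapping.lookup m i)"
proof
  assume *: "\<forall>i. Poly_Mapping.lookup g i \<le> Poly_Mapping.lookup m i"
  have "m = expo (\<lambda>i. Poly_Mapping.lookup m i - Poly_Mapping.lookup g i) + g"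
    by (rule poly_mapping_eqI) (simp add: lookup_add *)
  thus "\<exists>h. m = h + g" ..
qed (auto simp: lookup_add)

lemma single_dvd_single:
  fixes g m :: "'n::finite \<Rightarrow>\<^sub>0 nat"
  assumes "\<And>i. Poly_Mapping.lookup g i \<le> Poly_Mapping.lookup m i"
  shows "Poly_Mapping.single g (1 :: 'k::field) dvd Poly_Mapping.single m 1"
proof -
  obtain h where "m = h + g" using mono_divides_iff[of m g] assms by metis
  hence "Poly_Mapping.single m (1 :: 'k) = Poly_Mapping.single g 1 * Poly_Mapping.single h 1"
    by (simp add: mult_single add.commute)
  thus ?thesis by simp
qed

lemma in_monomial_ideal_iff:
  fixes f :: "('n::finite, 'k::field) mpoly"
  shows "f \<in> ideals.span ((\<lambda>m. Poly_Mapping.single m 1) ` M) \<longleftrightarrow>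
    (\<forall>m\<in>Poly_Mapping.keys f. \<exists>g\<in>M. \<forall>i. Poly_Mapping.lookup g i \<le> Poly_Mapping.lookup m i)"
    (is "f \<in> ?J \<longleftrightarrow> (\<forall>m\<in>_. ?Q m)")
proof
  have add: "?Q (m + m')" if "?Q m'" for m m'
  proof -
    obtain g where "g \<in> M" "\<And>i. Poly_Mapping.lookup g i \<le> Poly_Mapping.lookup m' i"
      using \<open>?Q m'\<close> by metis
    thus ?thesis by (intro bexI[of _ g]) (simp_all add: lookup_add trans_le_add2)
  qed
  assume "f \<in> ?J"
  thus "\<forall>m\<in>Poly_Mapping.keys f. ?Q m"
  proof (induction rule: ideals.span_induct_alt)
    case (step c x y)
    then obtain g where x: "x = Poly_Mapping.single g 1" "g \<in> M" by blast
    show ?case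
    proof
      fix m assume "m \<in> Poly_Mapping.keys (c * x + y)"
      then consider "m \<in> Poly_Mapping.keys (c * x)" | "m \<in> Poly_Mapping.keys y"
        using Poly_Mapping.keys_add[of "c * x" y] by blast
      thus "?Q m"
      proof cases
        case 1
        then obtain m' where "m = m' + g" using keys_mult[of c x] by (auto simp: x(1))
        thus ?thesis using add[of g m'] x(2) by blast
      qed (use step in blast)
    qed
  qed simp
next
  assume *: "\<forall>m\<in>Poly_Mapping.keys f. ?Q m"
  have "(\<Sum>m\<in>Poly_Mapping.keys f. Poly_Mapping.single m (Poly_Mapping.lookup f m)) \<in> ?J"
  proof (rule ideals.span_sum)
    fix m assume "m \<in> Poly_Mapping.keys f"
    with * obtain g where g: "g \<in> M" "\<forall>i. Poly_Mapping.lookup g i \<le> Poly_Mapping.lookup m i" by blast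
    then obtain h where "m = h + g" using mono_divides_iff[of m g] by blast
    hence "Poly_Mapping.single m (Poly_Mapping.lookup f m)
        = Poly_Mapping.single h (Poly_Mapping.lookup f m) * Poly_Mapping.single g 1"
      by (simp add: mult_single)
    also have "\<dots> \<in> ?J" using g(1) by (intro ideals.span_scale ideals.span_base) blast
    finally show "Poly_Mapping.single m (Poly_Mapping.lookup f m) \<in> ?J" .
  qed
  thus "f \<in> ?J" by (simp only: sum_keys_single)
qed

text \<open>The predicate \<open>Q\<close> on exponents is all that the socle and the chain
  condition need to know about the generators.\<close>

locale monomial_ideal =
  fixes Q :: "('n::finite \<Rightarrow>\<^sub>0 nat) \<Rightarrow> bool" and I :: "('n, 'k::field) mpoly set"
  assumes ideal: "ideals.subspace I"
    and mem: "f \<in> I \<longleftrightarrow> (\<forall>m\<in>Poly_Mapping.keys f. Q m)"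
begin

text \<open>Membership is tested term by term, so any monomial of a socle element that lies outside
  the ideal is itself a socle element.\<close>

lemma socle_degree_iff:
  "socle_degree I u \<longleftrightarrow>
    (\<exists>m. int (mono_deg m) = u \<and> \<not> Q m \<and> (\<forall>i. Q (Poly_Mapping.single i 1 + m)))"
proof
  assume "socle_degree I u"
  then obtain f where f: "homogeneous u f" "f \<notin> I" "\<And>i. Var i * f \<in> I"
    unfolding socle_degree_def by metis
  from f(2) obtain m where m: "m \<in> Poly_Mapping.keys f" "\<not> Q m" using mem by blast
  moreover have "Q (Poly_Mapping.single i 1 + m)" for i
    using f(3)[of i] m(1) unfolding mem keys_Var_mult by blast
  ultimately show "\<exists>m. int (mono_deg m) = u \<and> \<not> Q m \<and> (\<forall>i. Q (Poly_Mapping.single i 1 + m))"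
    using f(1) unfolding homogeneous_def by blast
next
  assume "\<exists>m. int (mono_deg m) = u \<and> \<not> Q m \<and> (\<forall>i. Q (Poly_Mapping.single i 1 + m))"
  then obtain m where m: "int (mono_deg m) = u" "\<not> Q m" "\<And>i. Q (Poly_Mapping.single i 1 + m)"
    by blast
  have "homogeneous u (Poly_Mapping.single m 1 :: ('n, 'k) mpoly)"
    using homogeneous_single[of m 1] m(1) by simp
  moreover have "Poly_Mapping.single m 1 \<notin> I" using m(2) by (simp add: mem)
  moreover have "Var i * Poly_Mapping.single m 1 \<in> I" for i
    using m(3) unfolding mem keys_Var_mult by simp
  ultimately show "socle_degree I u" unfolding socle_degree_def by blast
qed

text \<open>An ideal containing \<open>I\<close> is determined by its intersection with the span of
  the monomials outside \<open>I\<close>, a space of finite dimension.\<close>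

lemma artinian:
  assumes "finite {m. \<not> Q m}"
  shows "artinian_quotient I"
  unfolding artinian_quotient_def
proof (intro allI impI, elim conjE)
  fix J :: "nat \<Rightarrow> ('n, 'k) mpoly set"
  assume J: "\<forall>k. ideals.subspace (J k) \<and> I \<subseteq> J k" and dec: "\<forall>k. J (Suc k) \<subseteq> J k"
  define B :: "('n, 'k) mpoly set" where "B = (\<lambda>m. Poly_Mapping.single m 1) ` {m. \<not> Q m}"
  define U where "U k = J k \<inter> mpoly.span B" for k
  have B: "finite B" using assms by (simp add: B_def)
  have mono: "J l \<subseteq> J k" if "k \<le> l" for k l
    by (rule lift_Suc_antimono_le[of J]) (use dec that in simp_all)
  have subU: "mpoly.subspace (U k)" for k
    unfolding U_def using J
    by (intro mpoly.subspace_inter mpoly.subspace_span mpoly_subspace) simp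
  \<comment> \<open>The chain of subspaces \<open>U k\<close> decreases, so it is constant from any
    index of least dimension on.\<close>
  define N where "N = (ARG_MIN (\<lambda>k. mpoly.dim (U k)) k. True)"
  have N: "mpoly.dim (U N) \<le> mpoly.dim (U k)" for k
    unfolding N_def by (rule arg_min_nat_le) simp
  have UU: "U k = U N" if "k \<ge> N" for k
  proof (rule mpoly.subspace_eq_of_dim_eq[OF subU _ _ B])
    show le: "U k \<subseteq> U N" using mono[OF that] by (auto simp: U_def)
    show sp: "U N \<subseteq> mpoly.span B" by (auto simp: U_def)
    obtain C where C: "C \<subseteq> U N" "mpoly.independent C" "U N \<subseteq> mpoly.span C" "card C = mpoly.dim (U N)"
      using mpoly.basis_exists[of "U N"] by metis
    have "finite C"
      using mpoly.independent_span_bound[OF B C(2)] C(1) sp by (meson order_trans)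
    hence "mpoly.dim (U k) \<le> mpoly.dim (U N)"
      using mpoly.dim_le_card[of "U k" C] le C(3,4) by (metis order_trans)
    with N[of k] show "mpoly.dim (U k) = mpoly.dim (U N)" by simp
  qed
  show "\<exists>N. \<forall>k\<ge>N. J k = J N"
  proof (intro exI[of _ N] allI impI equalityI)
    fix k assume k: "k \<ge> N"
    show "J k \<subseteq> J N" by (rule mono[OF k])
    show "J N \<subseteq> J k"
    proof
      fix f assume f: "f \<in> J N"
      define fI where "fI = (\<Sum>m\<in>{m \<in> Poly_Mapping.keys f. Q m}. Poly_Mapping.single m
          (Poly_Mapping.lookup f m))"
      define fW where "fW = (\<Sum>m\<in>{m \<in> Poly_Mapping.keys f. \<not> Q m}. Poly_Mapping.single m
          (Poly_Mapping.lookup f m))"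
      have "fI + fW = (\<Sum>m\<in>{m \<in> Poly_Mapping.keys f. Q m} \<union> {m \<in> Poly_Mapping.keys f. \<not> Q m}.
          Poly_Mapping.single m (Poly_Mapping.lookup f m))"
        unfolding fI_def fW_def by (rule sum.union_disjoint[symmetric]) auto
      also have "{m \<in> Poly_Mapping.keys f. Q m} \<union> {m \<in> Poly_Mapping.keys f. \<not> Q m}
          = Poly_Mapping.keys f"
        by blast
      finally have split: "f = fI + fW" by (simp add: sum_keys_single)
      have "fI \<in> I"
        unfolding fI_def by (rule ideals.subspace_sum[OF ideal]) (simp add: mem)
      hence "fI \<in> J k" "fI \<in> J N" using J by blast+
      have "fW \<in> mpoly.span B"
        unfolding fW_def
      proof (rule mpoly.span_sum)
        fix m assume "m \<in> {m \<in> Poly_Mapping.keys f. \<not> Q m}"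
        hence "Poly_Mapping.single m 1 \<in> B" by (auto simp: B_def)
        from mpoly.span_scale[OF mpoly.span_base[OF this], of "Poly_Mapping.lookup f m"]
        show "Poly_Mapping.single m (Poly_Mapping.lookup f m) \<in> mpoly.span B"
          by (simp add: mult_single)
      qed
      moreover have "fW \<in> J N"
        using ideals.subspace_diff[of "J N" f fI] J f \<open>fI \<in> J N\<close> split by simp
      ultimately have "fW \<in> U k" unfolding UU[OF k] by (simp add: U_def)
      hence "fW \<in> J k" by (simp add: U_def)
      with \<open>fI \<in> J k\<close> show "f \<in> J k" unfolding split using J ideals.subspace_add by blast
    qed
  qed
qed

end

section \<open>The ideal generated by two monomials and powers of the variables\<close>

locale two_monomials =
  fixes a b e :: "'n::finite \<Rightarrow> nat"
  assumes less: "\<And>i. a i < e i" "\<And>i. b i < e i"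
begin

definition divisible :: "('n \<Rightarrow>\<^sub>0 nat) \<Rightarrow> bool"
  where "divisible m \<longleftrightarrow> (\<forall>i. a i \<le> Poly_Mapping.lookup m i) \<or> (\<forall>i. b i \<le> Poly_Mapping.lookup m i) \<or>
    (\<exists>i. e i \<le> Poly_Mapping.lookup m i)"

definition corner :: "('n \<Rightarrow>\<^sub>0 nat) \<Rightarrow> bool"
  where "corner m \<longleftrightarrow> \<not> divisible m \<and> (\<forall>i. divisible (Poly_Mapping.single i 1 + m))"

lemma lookup_shift:
  "Poly_Mapping.lookup (Poly_Mapping.single i 1 + m) k = (if k
      = i then Suc (Poly_Mapping.lookup m k) else Poly_Mapping.lookup m k)"
  by (simp add: lookup_add lookup_single when_def)

definition drop1 :: "'n \<Rightarrow> 'n \<Rightarrow>\<^sub>0 nat"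
  where "drop1 i = expo ((\<lambda>k. e k - 1)(i := min (a i) (b i) - 1))"

definition drop2 :: "'n \<Rightarrow> 'n \<Rightarrow> 'n \<Rightarrow>\<^sub>0 nat"
  where "drop2 i j = expo ((\<lambda>k. e k - 1)(i := a i - 1, j := b j - 1))"

text \<open>Coordinate \<open>i\<close> lies just below both \<open>a i\<close> and
  \<open>b i\<close> and blocks both monomials at once. Raising it frees the one with the smaller
  exponent there, since \<open>e - 1\<close> suffices elsewhere; raising another coordinate reaches
  its pure power.\<close>

lemma corner_drop1:
  assumes "a i > 0" and "b i > 0"
  shows "corner (drop1 i)"
  unfolding corner_def
proof (intro conjI allI)
  have "\<not> e k \<le> Poly_Mapping.lookup (drop1 i) k" for k
    using assms less[of k] less[of i] by (auto simp: drop1_def)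
  moreover have "Poly_Mapping.lookup (drop1 i) i < a i" "Poly_Mapping.lookup (drop1 i) i < b i"
    using assms by (simp_all add: drop1_def)
  ultimately show "\<not> divisible (drop1 i)" unfolding divisible_def by (meson leD)
  fix k
  show "divisible (Poly_Mapping.single k 1 + drop1 i)"
  proof (cases "k = i")
    case False
    hence "e k \<le> Poly_Mapping.lookup (Poly_Mapping.single k 1 + drop1 i) k"
      using less[of k] by (simp add: lookup_shift[simplified] drop1_def)
    thus ?thesis unfolding divisible_def by blast
  next
    case True
    have *: "Poly_Mapping.lookup (Poly_Mapping.single k 1 + drop1 i) l
        = (if l = i then min (a i) (b i) else e l - 1)" for l
      using assms True by (simp add: lookup_shift[simplified] drop1_def)
    have "a l \<le> e l - 1" "b l \<le> e l - 1" for l using less[of l] by simp_all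
    thus ?thesis unfolding divisible_def * by (cases "a i \<le> b i") auto
  qed
qed

text \<open>At \<open>i\<close> the exponent misses \<open>a\<close> by one but is still at least
  \<open>b\<close>; at \<open>j\<close> the roles are exchanged. Raising either one lets one of the
  two monomials divide, and raising any other coordinate reaches its pure power.\<close>

lemma corner_drop2:
  assumes "a i > b i" and "b j > a j"
  shows "corner (drop2 i j)"
  unfolding corner_def
proof (intro conjI allI)
  have ij: "i \<noteq> j" using assms by auto
  have "\<not> e k \<le> Poly_Mapping.lookup (drop2 i j) k" for k
    using less[of k] by (auto simp: drop2_def)
  moreover have "Poly_Mapping.lookup (drop2 i j) i < a i" "Poly_Mapping.lookup (drop2 i j) j < b j"
    using assms ij by (simp_all add: drop2_def)
  ultimately show "\<not> divisible (drop2 i j)" unfolding divisible_def by (meson leD)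
  fix k
  have le: "a l \<le> e l - 1" "b l \<le> e l - 1" for l using less[of l] by simp_all
  consider "k = i" | "k = j" | "k \<noteq> i" "k \<noteq> j" by blast
  thus "divisible (Poly_Mapping.single k 1 + drop2 i j)"
  proof cases
    case 1
    have "a l \<le> Poly_Mapping.lookup (Poly_Mapping.single k 1 + drop2 i j) l" for l
      using 1 assms ij le[of l] by (auto simp: lookup_shift[simplified] drop2_def)
    thus ?thesis unfolding divisible_def by blast
  next
    case 2
    have "b l \<le> Poly_Mapping.lookup (Poly_Mapping.single k 1 + drop2 i j) l" for l
      using 2 assms ij le[of l] by (auto simp: lookup_shift[simplified] drop2_def)
    thus ?thesis unfolding divisible_def by blast
  next
    case 3
    hence "e k \<le> Poly_Mapping.lookup (Poly_Mapping.single k 1 + drop2 i j) k"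
      using less[of k] by (simp add: lookup_shift[simplified] drop2_def)
    thus ?thesis unfolding divisible_def by blast
  qed
qed

text \<open>Some coordinate blocks the first monomial and some coordinate blocks the second. If one
  of them does both, it gives a \<open>drop1\<close>; otherwise two distinct ones give a
  \<open>drop2\<close>. Maximality then fixes every exponent.\<close>

lemma corner_cases:
  assumes "corner m"
  obtains i where "a i > 0" "b i > 0" "m = drop1 i"
  | i j where "a i > b i" "b j > a j" "m = drop2 i j"
proof -
  let ?m = "Poly_Mapping.lookup m"
  have nd: "\<not> divisible m" and d: "\<And>i. divisible (Poly_Mapping.single i 1 + m)"
    using assms by (simp_all add: corner_def)
  from nd have e: "?m k < e k" for k unfolding divisible_def by (meson leI)
  \<comment> \<open>Raising \<open>k\<close> leaves the blocking coordinates \<open>i\<close> and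
    \<open>j\<close> alone, so only the pure power at \<open>k\<close> can start to divide.\<close>
  have top: "?m k = e k - 1" if "?m i < a i" "?m j < b j" "k \<noteq> i" "k \<noteq> j" for i j k
  proof -
    have "\<not> a i \<le> Poly_Mapping.lookup (Poly_Mapping.single k 1 + m) i"
      "\<not> b j \<le> Poly_Mapping.lookup (Poly_Mapping.single k 1 + m) j"
      using that by (simp_all add: lookup_shift[simplified])
    with d[of k] obtain l where "e l \<le> Poly_Mapping.lookup (Poly_Mapping.single k 1 + m) l"
      unfolding divisible_def by blast
    with e[of l] have "l = k" "e k \<le> Suc (?m k)"
      by (auto simp: lookup_shift[simplified] split: if_splits)
    with e[of k] show ?thesis by simp
  qed
  show thesis
  proof (cases "\<exists>i. ?m i < a i \<and> ?m i < b i")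
    case True
    then obtain i where i: "?m i < a i" "?m i < b i" by blast
    have "Suc (?m i) \<ge> min (a i) (b i)"
    proof -
      consider "\<forall>k. a k \<le> Poly_Mapping.lookup (Poly_Mapping.single i 1 + m) k"
        | "\<forall>k. b k \<le> Poly_Mapping.lookup (Poly_Mapping.single i 1 + m) k"
        | k where "e k \<le> Poly_Mapping.lookup (Poly_Mapping.single i 1 + m) k"
        using d[of i] unfolding divisible_def by blast
      thus ?thesis
      proof cases
        case 1
        from spec[OF this, of i] show ?thesis by (simp add: lookup_shift[simplified])
      next
        case 2
        from spec[OF this, of i] show ?thesis by (simp add: lookup_shift[simplified])
      next
        case 3
        with e[of k] have "e i \<le> Suc (?m i)" by (simp add: lookup_shift[simplified] split: if_splits)
        with less[of i] show ?thesis by simp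
      qed
    qed
    hence mi: "?m i = min (a i) (b i) - 1" using i by linarith
    have "m = drop1 i"
      by (rule poly_mapping_eqI) (use mi top[OF i] in \<open>auto simp: drop1_def\<close>)
    thus thesis using that(1)[of i] i by simp
  next
    case False
    from nd obtain i j where ij: "?m i < a i" "?m j < b j" unfolding divisible_def by (meson leI)
    have bi: "b i \<le> ?m i" and aj: "a j \<le> ?m j" using False ij by (meson leI)+
    have ne: "i \<noteq> j" using bi ij by auto
    have "a i \<le> Suc (?m i)"
    proof -
      have "\<not> b j \<le> Poly_Mapping.lookup (Poly_Mapping.single i 1 + m) j"
        using ne ij by (simp add: lookup_shift[simplified])
      moreover have "\<not> e k \<le> Poly_Mapping.lookup (Poly_Mapping.single i 1 + m) k" for k
        using e[of k] ij(1) less[of i] by (auto simp: lookup_shift[simplified])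
      ultimately have "\<forall>k. a k \<le> Poly_Mapping.lookup (Poly_Mapping.single i 1 + m) k"
        using d[of i] unfolding divisible_def by blast
      from spec[OF this, of i] show ?thesis by (simp add: lookup_shift[simplified])
    qed
    moreover have "b j \<le> Suc (?m j)"
    proof -
      have "\<not> a i \<le> Poly_Mapping.lookup (Poly_Mapping.single j 1 + m) i"
        using ne ij by (simp add: lookup_shift[simplified])
      moreover have "\<not> e k \<le> Poly_Mapping.lookup (Poly_Mapping.single j 1 + m) k" for k
        using e[of k] ij(2) less[of j] by (auto simp: lookup_shift[simplified])
      ultimately have "\<forall>k. b k \<le> Poly_Mapping.lookup (Poly_Mapping.single j 1 + m) k"
        using d[of j] unfolding divisible_def by blast
      from spec[OF this, of j] show ?thesis by (simp add: lookup_shift[simplified])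
    qed
    ultimately have "?m i = a i - 1" "?m j = b j - 1" using ij by linarith+
    hence "m = drop2 i j"
      using top[OF ij] by (intro poly_mapping_eqI) (simp add: drop2_def)
    thus thesis using that(2)[of i j] bi aj ij by simp
  qed
qed

text \<open>The degree of the monomial with exponents \<open>e - 1\<close>, that is, the socle
  degree of the complete intersection cut out by the pure powers alone. Corner degrees are measured
  against it.\<close>

definition top_degree :: int
  where "top_degree = (\<Sum>k\<in>UNIV. int (e k) - 1)"

lemma degree_drop1:
  assumes "a i > 0" and "b i > 0"
  shows "int (mono_deg (drop1 i)) = top_degree + (int (min (a i) (b i)) - int (e i))"
proof -
  have e: "e k > 0" for k using less[of k] by simp
  have "int (mono_deg (drop1 i)) = (\<Sum>k\<in>UNIV. (int (e k) - 1) +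
      (if k = i then int (min (a i) (b i)) - int (e i) else 0))"
    unfolding drop1_def mono_deg_expo of_nat_sum
    using assms e by (intro sum.cong refl) (auto simp: of_nat_diff Suc_le_eq)
  thus ?thesis by (simp add: sum.distrib top_degree_def)
qed

lemma degree_drop2:
  assumes "a i > b i" and "b j > a j"
  shows "int (mono_deg (drop2 i j)) = top_degree + (int (a i) - int (e i)) + (int (b j) - int (e j))"
proof -
  have e: "e k > 0" for k using less[of k] by simp
  have ij: "i \<noteq> j" using assms by auto
  have "int (mono_deg (drop2 i j)) = (\<Sum>k\<in>UNIV. (int (e k) - 1) +
      (if k = i then int (a i) - int (e i) else 0) + (if k = j then int (b j) - int (e j) else 0))"
    unfolding drop2_def mono_deg_expo of_nat_sum
    using assms e ij by (intro sum.cong refl) (auto simp: of_nat_diff Suc_le_eq)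
  thus ?thesis by (simp add: sum.distrib top_degree_def)
qed

lemma corner_degrees:
  "(\<exists>m. int (mono_deg m) = u \<and> corner m) \<longleftrightarrow>
    (\<exists>i. a i > 0 \<and> b i > 0 \<and> u = top_degree + (int (min (a i) (b i)) - int (e i))) \<or>
    (\<exists>i j. a i > b i \<and> b j > a j \<and>
      u = top_degree + (int (a i) - int (e i)) + (int (b j) - int (e j)))"
proof
  assume "\<exists>m. int (mono_deg m) = u \<and> corner m"
  then obtain m where "int (mono_deg m) = u" "corner m" by blast
  from this(2) show "(\<exists>i. a i > 0 \<and> b i > 0 \<and> u = top_degree + (int (min (a i) (b i)) - int (e i))) \<or>
    (\<exists>i j. a i > b i \<and> b j > a j \<and>
      u = top_degree + (int (a i) - int (e i)) + (int (b j) - int (e j)))"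
    by (cases m rule: corner_cases)
      (use \<open>int (mono_deg m) = u\<close> degree_drop1 degree_drop2 in blast)+
next
  assume "(\<exists>i. a i > 0 \<and> b i > 0 \<and> u = top_degree + (int (min (a i) (b i)) - int (e i))) \<or>
    (\<exists>i j. a i > b i \<and> b j > a j \<and>
      u = top_degree + (int (a i) - int (e i)) + (int (b j) - int (e j)))"
  thus "\<exists>m. int (mono_deg m) = u \<and> corner m"
    using corner_drop1 corner_drop2 degree_drop1 degree_drop2 by metis
qed

lemma divisible_large_degree:
  assumes "int (mono_deg m) \<ge> (\<Sum>k\<in>UNIV. int (e k))"
  shows "divisible m"
proof (rule ccontr)
  assume "\<not> divisible m"
  hence "Poly_Mapping.lookup m k < e k" for k unfolding divisible_def by (meson leI)
  hence "mono_deg m < sum e UNIV" unfolding mono_deg_def by (intro sum_strict_mono) simp_all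
  with assms show False by (simp flip: of_nat_sum)
qed

end

theorem corollary6p6:
  fixes a b e :: "'n::finite \<Rightarrow> nat"
    and u\<^sub>1 u\<^sub>2 :: "('n, 'k::field) mpoly"
    and I :: "('n, 'k) mpoly set"
    and P\<^sub>0 P\<^sub>1 P\<^sub>2 A B :: "'n set"
  defines "u\<^sub>1 \<equiv> \<Prod>i\<in>UNIV. Var i ^ a i"
    and "u\<^sub>2 \<equiv> \<Prod>i\<in>UNIV. Var i ^ b i"
    and "I \<equiv> ideal_gen ({u\<^sub>1, u\<^sub>2} \<union> range (\<lambda>i. Var i ^ e i))"
    and "P\<^sub>0 \<equiv> {i. a i = b i}"
    and "P\<^sub>1 \<equiv> {i. a i > b i}"
    and "P\<^sub>2 \<equiv> {i. a i < b i}"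
    and "A \<equiv> {i. a i > 0}"
    and "B \<equiv> {i. b i > 0}"
  assumes "\<not> u\<^sub>1 dvd u\<^sub>2" and "\<not> u\<^sub>2 dvd u\<^sub>1"
    and "\<And>i k. u\<^sub>1 \<noteq> Var i ^ k" and "\<And>i k. u\<^sub>2 \<noteq> Var i ^ k"
    and "\<And>i. a i + b i > 0"
    and "\<And>i. e i > max (a i) (b i)"
  shows "level_algebra I \<longleftrightarrow>
    (\<exists>\<alpha> \<beta> \<gamma> :: int.
      (\<forall>i\<in>P\<^sub>1. int (a i) - int (e i) = \<alpha>) \<and>
      (\<forall>i\<in>P\<^sub>2. int (b i) - int (e i) = \<beta>) \<and>
      (\<forall>i\<in>(P\<^sub>2 \<inter> A) \<union> P\<^sub>0. int (a i) - int (e i) = \<gamma>) \<and>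
      (\<forall>j\<in>P\<^sub>1 \<inter> B. int (b j) - int (e j) = \<gamma>) \<and>
      \<gamma> = \<alpha> + \<beta>)"
proof -
  interpret two_monomials a b e
    by unfold_locales (use assms(14) in auto)
  define M where "M = {expo a, expo b} \<union> range (\<lambda>i. Poly_Mapping.single i (e i))"
  have u: "u\<^sub>1 = Poly_Mapping.single (expo a) 1" "u\<^sub>2 = Poly_Mapping.single (expo b) 1"
    unfolding u\<^sub>1_def u\<^sub>2_def by (rule prod_Var_power)+
  have gens: "{u\<^sub>1, u\<^sub>2} \<union> range (\<lambda>i. Var i ^ e i) = (\<lambda>m. Poly_Mapping.single m 1) ` M"
    unfolding u Var_power by (auto simp: M_def)
  have I: "I = ideals.span ((\<lambda>m. Poly_Mapping.single m 1) ` M)" unfolding I_def gens ..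
  have "(\<exists>g\<in>M. \<forall>i. Poly_Mapping.lookup g i \<le> Poly_Mapping.lookup m i) \<longleftrightarrow> divisible m" for m
  proof -
    have "(\<forall>k. Poly_Mapping.lookup (Poly_Mapping.single i (e i)) k \<le> Poly_Mapping.lookup m k)
        \<longleftrightarrow> e i \<le> Poly_Mapping.lookup m i" for i
      by (auto simp: lookup_single when_def)
    thus ?thesis by (auto simp: M_def divisible_def)
  qed
  hence mem: "f \<in> I \<longleftrightarrow> (\<forall>m\<in>Poly_Mapping.keys f. divisible m)" for f
    unfolding I in_monomial_ideal_iff by simp
  interpret monomial_ideal divisible I
    by unfold_locales (simp add: I, rule mem)
  have hom: "homogeneous_ideal I"
    unfolding homogeneous_ideal_def I
    by (intro exI[of _ "(\<lambda>m. Poly_Mapping.single m 1) ` M"]) (auto intro: homogeneous_single)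
  have "{m. \<not> divisible m} \<subseteq> {m. mono_deg m \<le> sum e UNIV}"
    using divisible_large_degree by (force simp flip: of_nat_sum)
  hence art: "artinian_quotient I"
    using finite_subset finite_mono_deg_le by (intro artinian) blast
  \<comment> \<open>Failure of divisibility in either direction gives a member of
    \<open>P\<^sub>1\<close> and one of \<open>P\<^sub>2\<close>; they supply the corner that serves
    as reference.\<close>
  obtain i\<^sub>0 where i\<^sub>0: "a i\<^sub>0 > b i\<^sub>0"
    using assms(9) single_dvd_single[of "expo a" "expo b"] unfolding u
    by (metis lookup_expo not_le)
  obtain j\<^sub>0 where j\<^sub>0: "b j\<^sub>0 > a j\<^sub>0"
    using assms(10) single_dvd_single[of "expo b" "expo a"] unfolding u
    by (metis lookup_expo not_le)
  have proper: "1 \<notin> I"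
  proof -
    have "\<not> divisible 0"
      unfolding divisible_def using i\<^sub>0 j\<^sub>0 less by (metis leD lookup_zero not_less_zero le_zero_eq)
    thus ?thesis by (simp add: mem)
  qed
  have bounded: "f \<in> I" if "u \<ge> (\<Sum>k\<in>UNIV. int (e k))" "homogeneous u f" for u f
    unfolding mem using that divisible_large_degree by (simp add: homogeneous_def)
  have socle: "socle_degree I u \<longleftrightarrow>
    (\<exists>i. a i > 0 \<and> b i > 0 \<and> u = top_degree + (int (min (a i) (b i)) - int (e i))) \<or>
    (\<exists>i j. a i > b i \<and> b j > a j \<and>
      u = top_degree + (int (a i) - int (e i)) + (int (b j) - int (e j)))" for u
    unfolding socle_degree_iff corner_degrees[symmetric] corner_def by blast
  \<comment> \<open>These are the only possible values of \<open>\<alpha>\<close> and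
    \<open>\<beta>\<close>, and \<open>top_degree + \<alpha>\<^sub>0 + \<beta>\<^sub>0\<close> is
    the degree of \<open>drop2 i\<^sub>0 j\<^sub>0\<close>.\<close>
  define \<alpha>\<^sub>0 where "\<alpha>\<^sub>0 = int (a i\<^sub>0) - int (e i\<^sub>0)"
  define \<beta>\<^sub>0 where "\<beta>\<^sub>0 = int (b j\<^sub>0) - int (e j\<^sub>0)"
  have "socle_degree I (top_degree + \<alpha>\<^sub>0 + \<beta>\<^sub>0)"
    unfolding socle \<alpha>\<^sub>0_def \<beta>\<^sub>0_def using i\<^sub>0 j\<^sub>0 by blast
  from level_iff_socle_degree_unique[OF hom art proper bounded this]
  have "level_algebra I \<longleftrightarrow> (\<forall>u. socle_degree I u \<longrightarrow> u = top_degree + \<alpha>\<^sub>0 + \<beta>\<^sub>0)" .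
  also have "\<dots> \<longleftrightarrow>
      (\<forall>i. a i > 0 \<and> b i > 0 \<longrightarrow> int (min (a i) (b i)) - int (e i) = \<alpha>\<^sub>0 + \<beta>\<^sub>0) \<and>
      (\<forall>i j. a i > b i \<and> b j > a j \<longrightarrow>
        (int (a i) - int (e i)) + (int (b j) - int (e j)) = \<alpha>\<^sub>0 + \<beta>\<^sub>0)"
    (is "_ \<longleftrightarrow> ?one \<and> ?two")
  proof (intro iffI conjI allI impI)
    fix i assume *: "\<forall>u. socle_degree I u \<longrightarrow> u = top_degree + \<alpha>\<^sub>0 + \<beta>\<^sub>0" and "a i > 0 \<and> b i > 0"
    hence "socle_degree I (top_degree + (int (min (a i) (b i)) - int (e i)))"
      unfolding socle by blast
    with * show "int (min (a i) (b i)) - int (e i) = \<alpha>\<^sub>0 + \<beta>\<^sub>0" by fastforce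
  next
    fix i j assume *: "\<forall>u. socle_degree I u \<longrightarrow> u = top_degree + \<alpha>\<^sub>0 + \<beta>\<^sub>0" and "a i > b i \<and> b j > a j"
    hence "socle_degree I (top_degree + (int (a i) - int (e i)) + (int (b j) - int (e j)))"
      unfolding socle by blast
    with * show "(int (a i) - int (e i)) + (int (b j) - int (e j)) = \<alpha>\<^sub>0 + \<beta>\<^sub>0" by fastforce
  next
    fix u assume *: "?one \<and> ?two" and "socle_degree I u"
    from this(2) consider i where "a i > 0 \<and> b i > 0"
        "u = top_degree + (int (min (a i) (b i)) - int (e i))"
      | i j where "a i > b i \<and> b j > a j"
        "u = top_degree + (int (a i) - int (e i)) + (int (b j) - int (e j))"
      unfolding socle by blast
    thus "u = top_degree + \<alpha>\<^sub>0 + \<beta>\<^sub>0"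
    proof cases
      case (1 i)
      with * have "int (min (a i) (b i)) - int (e i) = \<alpha>\<^sub>0 + \<beta>\<^sub>0" by blast
      with 1(2) show ?thesis by linarith
    next
      case (2 i j)
      with * have "(int (a i) - int (e i)) + (int (b j) - int (e j)) = \<alpha>\<^sub>0 + \<beta>\<^sub>0" by blast
      with 2(2) show ?thesis by linarith
    qed
  qed
  also have "\<dots> \<longleftrightarrow> (\<exists>\<alpha> \<beta> \<gamma> :: int.
      (\<forall>i\<in>P\<^sub>1. int (a i) - int (e i) = \<alpha>) \<and>
      (\<forall>i\<in>P\<^sub>2. int (b i) - int (e i) = \<beta>) \<and>
      (\<forall>i\<in>(P\<^sub>2 \<inter> A) \<union> P\<^sub>0. int (a i) - int (e i) = \<gamma>) \<and>
      (\<forall>j\<in>P\<^sub>1 \<inter> B. int (b j) - int (e j) = \<gamma>) \<and>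
      \<gamma> = \<alpha> + \<beta>)" (is "_ \<longleftrightarrow> ?rhs")
  proof
    assume *: "?one \<and> ?two"
    show ?rhs
    proof (intro exI conjI ballI)
      \<comment> \<open>Fixing \<open>j\<^sub>0\<close> in the condition on pairs cancels
        \<open>\<beta>\<^sub>0\<close> and isolates the contribution of \<open>i\<close>; the next
        step does the same with \<open>i\<^sub>0\<close>.\<close>
      show "int (a i) - int (e i) = \<alpha>\<^sub>0" if "i \<in> P\<^sub>1" for i
        using * that j\<^sub>0 unfolding P\<^sub>1_def \<beta>\<^sub>0_def by fastforce
      show "int (b i) - int (e i) = \<beta>\<^sub>0" if "i \<in> P\<^sub>2" for i
        using * that i\<^sub>0 unfolding P\<^sub>2_def \<alpha>\<^sub>0_def by fastforce
      show "int (a i) - int (e i) = \<alpha>\<^sub>0 + \<beta>\<^sub>0" if "i \<in> (P\<^sub>2 \<inter> A) \<union> P\<^sub>0" for i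
      proof -
        \<comment> \<open>On \<open>P\<^sub>0\<close> positivity comes from
          \<open>a i + b i > 0\<close>, on \<open>P\<^sub>2\<close> from membership in
          \<open>A\<close>.\<close>
        have "a i > 0" "b i > 0" "min (a i) (b i) = a i"
          using that assms(13)[of i] by (auto simp: P\<^sub>2_def P\<^sub>0_def A_def)
        with * show ?thesis by metis
      qed
      show "int (b i) - int (e i) = \<alpha>\<^sub>0 + \<beta>\<^sub>0" if "i \<in> P\<^sub>1 \<inter> B" for i
      proof -
        have "a i > 0" "b i > 0" "min (a i) (b i) = b i"
          using that by (auto simp: P\<^sub>1_def B_def)
        with * show ?thesis by metis
      qed
    qed (rule refl)
  next
    assume ?rhs
    then obtain \<alpha> \<beta> where
      1: "\<And>i. i \<in> P\<^sub>1 \<Longrightarrow> int (a i) - int (e i) = \<alpha>" and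
      2: "\<And>i. i \<in> P\<^sub>2 \<Longrightarrow> int (b i) - int (e i) = \<beta>" and
      3: "\<And>i. i \<in> (P\<^sub>2 \<inter> A) \<union> P\<^sub>0 \<Longrightarrow> int (a i) - int (e i) = \<alpha> + \<beta>" and
      4: "\<And>i. i \<in> P\<^sub>1 \<inter> B \<Longrightarrow> int (b i) - int (e i) = \<alpha> + \<beta>"
      by blast
    \<comment> \<open>Evaluating (i) and (ii) at \<open>i\<^sub>0\<close> and
      \<open>j\<^sub>0\<close> identifies the given constants with the reference values.\<close>
    have \<alpha>\<beta>: "\<alpha>\<^sub>0 = \<alpha>" "\<beta>\<^sub>0 = \<beta>"
      using 1[of i\<^sub>0] 2[of j\<^sub>0] i\<^sub>0 j\<^sub>0 by (simp_all add: \<alpha>\<^sub>0_def \<beta>\<^sub>0_def P\<^sub>1_def P\<^sub>2_def)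
    show "?one \<and> ?two"
    proof (intro conjI allI impI; elim conjE)
      fix i assume i: "a i > 0" "b i > 0"
      show "int (min (a i) (b i)) - int (e i) = \<alpha>\<^sub>0 + \<beta>\<^sub>0"
      proof (cases "a i \<le> b i")
        case True
        hence "i \<in> (P\<^sub>2 \<inter> A) \<union> P\<^sub>0" using i by (auto simp: P\<^sub>2_def P\<^sub>0_def A_def)
        from 3[OF this] True show ?thesis by (simp add: \<alpha>\<beta> min_def)
      next
        case False
        hence "i \<in> P\<^sub>1 \<inter> B" using i by (auto simp: P\<^sub>1_def B_def)
        from 4[OF this] False show ?thesis by (simp add: \<alpha>\<beta> min_def)
      qed
    next
      fix i j assume "a i > b i" "b j > a j"
      with 1[of i] 2[of j] show "(int (a i) - int (e i)) + (int (b j) - int (e j)) = \<alpha>\<^sub>0 + \<beta>\<^sub>0"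
        by (simp add: P\<^sub>1_def P\<^sub>2_def \<alpha>\<beta>)
    qed
  qed
  finally show ?thesis .
qed

end
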